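(* Let $(\Omega,\mathscr{F},\mu)$ be a complete probability space and let $K\subset L^{0}(\mu)$ be absolutely convex, closed in probability and bounded in probability. Let $E_K=\mathrm{span}(K)$ and let $\varphi:E_K\to(-\infty,\infty]$ be a convex and proper function. Then for any equicontinuous Köthe topology $\tau$ on $E_K$ the following are equivalent: (1) $\{\varphi\leq\lambda\}\cap\varepsilon K$ is $\tau$-closed for every $\lambda\in\mathbb{R}$ and every $\varepsilon>0$; (2) $\varphi$ has the equicontinuous Fatou property. If, furthermore, $\tau$ has the Krein-Šmulian property, then (1) and (2) are also equivalent to lower semicontinuity of $\varphi$ with respect to $\tau$.
   Context: $L^{0}(\mu)$ carries the topology of convergence in probability. The polar of $C\subset L^{0}(\mu)$ is $C^{\circ}=\{g\in L^{0}(\mu):\sup_{f\in C}\int_\Omega|fg|\,d\mu\leq1\}$; set $E'_K=\mathrm{span}(K^{\circ})$, paired with $E_K$ via $\langle f,g\rangle=\int_\Omega fg\,d\mu$. For $F\subset E'_K$, $\sigma(E_K,F)$ is the weak topology on $E_K$ induced by this pairing. A subset $A\subset E_K$ (or a sequence) is $K$-bounded if $A\subset\lambda K$ for some $\lambda>0$. A convex proper $\varphi:E_K\to(-\infty,\infty]$ has the equicontinuous Fatou property if every $K$-bounded sequence $(f_n)$ converging in probability to $f\in E_K$ satisfies $\varphi(f)\leq\liminf_n\varphi(f_n)$. A topology $\tau$ on $E_K$ is an equicontinuous Köthe topology if $K$ is $\tau$-compact and $\tau$ restricted to $K$-bounded sets equals $\sigma(E_K,F)$ for some $F\subset E'_K$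 that is solid (in $L^0(\mu)$), separates the points of $E_K$, and contains a strictly positive element; $F$ is then said to induce $\tau$. Such $\tau$ has the Krein-Šmulian property if a convex set $C\subset E_K$ is $\tau$-closed if and only if $C\cap\lambda K$ is $\tau$-closed for each $\lambda>0$. *)

theory Defs
  imports "HOL-Probability.Probability"
begin

text \<open>Elements of L^0(mu) are represented by real-valued measurable functions
  (members of borel_measurable M); classes are handled by working modulo
  almost-everywhere equality.\<close>

definition ae_eq :: "'a measure \<Rightarrow> ('a \<Rightarrow> real) \<Rightarrow> ('a \<Rightarrow> real) \<Rightarrow> bool" where
  "ae_eq M f g \<longleftrightarrow> (AE x in M. f x = g x)"

definition conv_in_prob :: "'a measure \<Rightarrow> (nat \<Rightarrow> 'a \<Rightarrow> real) \<Rightarrow> ('a \<Rightarrow> real) \<Rightarrow> bool" where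
  "conv_in_prob M fs f \<longleftrightarrow>
     (\<forall>e>0. (\<lambda>n. measure M {x \<in> space M. e < \<bar>fs n x - f x\<bar>}) \<longlonglongrightarrow> 0)"

text \<open>Closed in probability (L^0 is metrizable, so closed = sequentially closed).\<close>
definition closed_in_prob :: "'a measure \<Rightarrow> ('a \<Rightarrow> real) set \<Rightarrow> bool" where
  "closed_in_prob M C \<longleftrightarrow> C \<subseteq> borel_measurable M \<and>
     (\<forall>fs f. (\<forall>n. fs n \<in> C) \<longrightarrow> f \<in> borel_measurable M \<longrightarrow> conv_in_prob M fs f \<longrightarrow> f \<in> C)"

definition bounded_in_prob :: "'a measure \<Rightarrow> ('a \<Rightarrow> real) set \<Rightarrow> bool" where
  "bounded_in_prob M C \<longleftrightarrow>
     (\<forall>e>0. \<exists>c. \<forall>f\<in>C. measure M {x \<in> space M. c < \<bar>f x\<bar>} \<le> e)"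

definition absolutely_convex :: "('a \<Rightarrow> real) set \<Rightarrow> bool" where
  "absolutely_convex C \<longleftrightarrow>
     (\<forall>f\<in>C. \<forall>g\<in>C. \<forall>a b::real. \<bar>a\<bar> + \<bar>b\<bar> \<le> 1 \<longrightarrow> (\<lambda>x. a * f x + b * g x) \<in> C)"

definition L0_span :: "'a measure \<Rightarrow> ('a \<Rightarrow> real) set \<Rightarrow> ('a \<Rightarrow> real) set" where
  "L0_span M C = {f \<in> borel_measurable M. \<exists>n (c::nat \<Rightarrow> real) g.
      (\<forall>i<n. g i \<in> C) \<and> ae_eq M f (\<lambda>x. \<Sum>i<n. c i * g i x)}"

definition scale_set :: "real \<Rightarrow> ('a \<Rightarrow> real) set \<Rightarrow> ('a \<Rightarrow> real) set" where
  "scale_set l C = {h. \<exists>f\<in>C. h = (\<lambda>x. l * f x)}"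

definition polar :: "'a measure \<Rightarrow> ('a \<Rightarrow> real) set \<Rightarrow> ('a \<Rightarrow> real) set" where
  "polar M C = {g \<in> borel_measurable M.
      (SUP f\<in>C. \<integral>\<^sup>+ x. ennreal \<bar>f x * g x\<bar> \<partial>M) \<le> 1}"

definition pairing :: "'a measure \<Rightarrow> ('a \<Rightarrow> real) \<Rightarrow> ('a \<Rightarrow> real) \<Rightarrow> real" where
  "pairing M f g = (\<integral> x. f x * g x \<partial>M)"

definition weak_top :: "'a measure \<Rightarrow> ('a \<Rightarrow> real) set \<Rightarrow> ('a \<Rightarrow> real) set \<Rightarrow> ('a \<Rightarrow> real) topology" where
  "weak_top M E F = pullback_topology E (\<lambda>f. restrict (\<lambda>g. pairing M f g) F)
                      (product_topology (\<lambda>_. euclideanreal) F)"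

definition solid :: "'a measure \<Rightarrow> ('a \<Rightarrow> real) set \<Rightarrow> bool" where
  "solid M F \<longleftrightarrow> (\<forall>g\<in>F. \<forall>h\<in>borel_measurable M.
      (AE x in M. \<bar>h x\<bar> \<le> \<bar>g x\<bar>) \<longrightarrow> h \<in> F)"

definition separates_points :: "'a measure \<Rightarrow> ('a \<Rightarrow> real) set \<Rightarrow> ('a \<Rightarrow> real) set \<Rightarrow> bool" where
  "separates_points M F E \<longleftrightarrow> (\<forall>f\<in>E. \<forall>g\<in>E. \<not> ae_eq M f g \<longrightarrow>
      (\<exists>h\<in>F. pairing M f h \<noteq> pairing M g h))"

definition K_bounded :: "('a \<Rightarrow> real) set \<Rightarrow> ('a \<Rightarrow> real) set \<Rightarrow> bool" where
  "K_bounded K A \<longleftrightarrow> (\<exists>l>0. A \<subseteq> scale_set l K)"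

definition equicont_Koethe_topology ::
  "'a measure \<Rightarrow> ('a \<Rightarrow> real) set \<Rightarrow> ('a \<Rightarrow> real) topology \<Rightarrow> bool" where
  "equicont_Koethe_topology M K \<tau> \<longleftrightarrow>
     topspace \<tau> = L0_span M K \<and> compactin \<tau> K \<and>
     (\<exists>F. F \<subseteq> L0_span M (polar M K) \<and> solid M F \<and> separates_points M F (L0_span M K) \<and>
          (\<exists>h\<in>F. AE x in M. 0 < h x) \<and>
          (\<forall>A. K_bounded K A \<longrightarrow>
              subtopology \<tau> A = subtopology (weak_top M (L0_span M K) F) A))"

definition convex_fset :: "('a \<Rightarrow> real) set \<Rightarrow> bool" where
  "convex_fset C \<longleftrightarrow> (\<forall>f\<in>C. \<forall>g\<in>C. \<forall>t::real. 0 \<le> t \<and> t \<le> 1 \<longrightarrow>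
      (\<lambda>x. t * f x + (1 - t) * g x) \<in> C)"

definition Krein_Smulian :: "('a \<Rightarrow> real) set \<Rightarrow> ('a \<Rightarrow> real) topology \<Rightarrow> bool" where
  "Krein_Smulian K \<tau> \<longleftrightarrow> (\<forall>C. C \<subseteq> topspace \<tau> \<longrightarrow> convex_fset C \<longrightarrow>
      (closedin \<tau> C \<longleftrightarrow> (\<forall>l>0. closedin \<tau> (C \<inter> scale_set l K))))"

text \<open>phi : E -> (-inf, inf], convex and proper; phi is a function on L^0-classes,
  i.e. it does not depend on the representative.\<close>
definition convex_proper_on :: "'a measure \<Rightarrow> ('a \<Rightarrow> real) set \<Rightarrow> (('a \<Rightarrow> real) \<Rightarrow> ereal) \<Rightarrow> bool" where
  "convex_proper_on M E \<phi> \<longleftrightarrow>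
     (\<forall>f\<in>E. \<forall>g\<in>E. ae_eq M f g \<longrightarrow> \<phi> f = \<phi> g) \<and>
     (\<forall>f\<in>E. \<phi> f \<noteq> -\<infinity>) \<and> (\<exists>f\<in>E. \<phi> f \<noteq> \<infinity>) \<and>
     (\<forall>f\<in>E. \<forall>g\<in>E. \<forall>t::real. 0 \<le> t \<and> t \<le> 1 \<longrightarrow>
        \<phi> (\<lambda>x. t * f x + (1 - t) * g x) \<le> ereal t * \<phi> f + ereal (1 - t) * \<phi> g)"

definition equicont_Fatou :: "'a measure \<Rightarrow> ('a \<Rightarrow> real) set \<Rightarrow> (('a \<Rightarrow> real) \<Rightarrow> ereal) \<Rightarrow> bool" where
  "equicont_Fatou M K \<phi> \<longleftrightarrow> (\<forall>fs f. K_bounded K (range fs) \<longrightarrow> f \<in> L0_span M K \<longrightarrow>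
      conv_in_prob M fs f \<longrightarrow> \<phi> f \<le> liminf (\<lambda>n. \<phi> (fs n)))"

definition lsc_wrt :: "'b topology \<Rightarrow> ('b \<Rightarrow> ereal) \<Rightarrow> bool" where
  "lsc_wrt \<tau> \<phi> \<longleftrightarrow> (\<forall>x\<in>topspace \<tau>. \<forall>c. c < \<phi> x \<longrightarrow>
      (\<exists>U. openin \<tau> U \<and> x \<in> U \<and> (\<forall>y\<in>U. c < \<phi> y)))"

end

theory Submission
  imports Defs
begin

text \<open>On bounded sets \<open>\<tau>\<close> is the weak topology of a solid space \<open>F\<close> containing a strictly positive
  weight \<open>h \<le> 1\<close>, so everything reduces to comparing weak closedness of the sets
  \<open>C = {\<phi> \<le> c} \<inter> \<epsilon>K\<close> with closedness under almost sure limits.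

  If \<open>C\<close> is closed, it is weakly compact, so an almost surely convergent sequence in \<open>C\<close> has a weak
  cluster point in \<open>C\<close>; testing against \<open>h\<close> times signs on the sets where the sequence is
  bounded by \<open>k\<close> identifies the cluster point with the almost sure limit.

  Conversely, let the convex set \<open>C\<close> be closed under almost sure limits and \<open>f\<close> in its weak closure.
  By strict convexity a minimising sequence of \<open>c \<mapsto> \<integral> sqrt (1 + (c - f)\<^sup>2) h\<close> on \<open>C\<close> is Cauchy in
  probability, so there is a minimiser \<open>c\<close>. The first-order condition says that the functional
  \<open>g = (c - f) / sqrt (1 + (c - f)\<^sup>2) * h\<close>, which lies in \<open>F\<close> by solidity, is minimal on \<open>C\<close> at
  \<open>c\<close>, hence \<open>\<integral> (f - c) g \<ge> 0\<close>, and this forces \<open>f = c\<close>.\<close>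

section \<open>Strict convexity of the smooth absolute value\<close>

text \<open>Cauchy-Schwarz for the vectors \<open>(1, a)\<close> and \<open>(1, b)\<close> gives
  \<open>1 + a * b \<le> u * v\<close>; subtracting this from
  \<open>u\<^sup>2 = 1 + a\<^sup>2\<close> and dividing by \<open>u\<close> yields the gradient
  inequality of a convex function.\<close>

lemma sqrt_one_plus_sq_gradient:
  fixes a b :: real
  shows "sqrt (1 + a\<^sup>2) - sqrt (1 + b\<^sup>2) \<le> (a - b) * (a / sqrt (1 + a\<^sup>2))"
proof -
  define u where "u = sqrt (1 + a\<^sup>2)"
  define v where "v = sqrt (1 + b\<^sup>2)"
  have u: "u > 0" "u\<^sup>2 = 1 + a\<^sup>2" and v: "v > 0" "v\<^sup>2 = 1 + b\<^sup>2"
    by (auto simp: u_def v_def add_pos_nonneg)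
  have "(1 + a * b)\<^sup>2 \<le> (u * v)\<^sup>2"
  proof -
    have "(u * v)\<^sup>2 = (1 + a * b)\<^sup>2 + (a - b)\<^sup>2"
      by (simp add: power_mult_distrib u v) (simp add: power2_eq_square algebra_simps)
    then show ?thesis by simp
  qed
  then have "1 + a * b \<le> u * v"
    by (rule power2_le_imp_le) (use u v in simp)
  then have "(u - v) * u \<le> (a - b) * a"
    using u(2) by (simp add: power2_eq_square algebra_simps)
  then have "u - v \<le> (a - b) * a / u"
    by (simp only: pos_le_divide_eq[OF u(1)])
  then show ?thesis by (simp add: u_def v_def)
qed

lemma abs_div_sqrt_one_plus_sq_le:
  fixes r :: real
  shows "\<bar>r / sqrt (1 + r\<^sup>2)\<bar> \<le> 1"
proof -
  have "sqrt (1 + r\<^sup>2) > 0" by (simp add: add_pos_nonneg)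
  then show ?thesis by (simp add: divide_le_eq real_le_rsqrt)
qed

text \<open>The midpoint gap is the defect \<open>u + v - w\<close> in the triangle inequality for
  \<open>(1, s)\<close> and \<open>(1, t)\<close>. Lagrange's identity writes
  \<open>(s - t)\<^sup>2\<close> as \<open>(u * v)\<^sup>2 - (1 + s * t)\<^sup>2\<close>, and
  \<open>u * v - (1 + s * t)\<close> is half of \<open>(u + v)\<^sup>2 - w\<^sup>2\<close>, which
  has the defect as a factor.\<close>

lemma sqrt_one_plus_sq_strict_convex:
  fixes s t :: real
  defines "\<psi> \<equiv> \<lambda>r::real. sqrt (1 + r\<^sup>2)"
  shows "(s - t)\<^sup>2 \<le> (\<psi> s + \<psi> t) ^ 3 * (\<psi> s + \<psi> t - 2 * \<psi> ((s + t) / 2))"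
    and "0 \<le> \<psi> s + \<psi> t - 2 * \<psi> ((s + t) / 2)"
proof -
  define u v w where "u = \<psi> s" and "v = \<psi> t" and "w = 2 * \<psi> ((s + t) / 2)"
  have u: "u > 0" "u\<^sup>2 = 1 + s\<^sup>2" and v: "v > 0" "v\<^sup>2 = 1 + t\<^sup>2"
    and w: "w > 0" "w\<^sup>2 = 4 + (s + t)\<^sup>2"
    by (auto simp: u_def v_def w_def \<psi>_def add_pos_nonneg power_mult_distrib power_divide)
  have uv: "(u * v)\<^sup>2 = (1 + s * t)\<^sup>2 + (s - t)\<^sup>2"
    by (simp add: power_mult_distrib u v) (simp add: power2_eq_square algebra_simps)
  then have "\<bar>1 + s * t\<bar> \<le> \<bar>u * v\<bar>"
    unfolding abs_le_square_iff by simp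
  then have le: "1 + s * t \<le> u * v"
    using u v by simp
  have diff: "(u + v)\<^sup>2 - w\<^sup>2 = 2 * (u * v - (1 + s * t))"
    using u v w by (simp add: power2_eq_square algebra_simps)
  then have "w\<^sup>2 \<le> (u + v)\<^sup>2" using le by simp
  then have wle: "w \<le> u + v" by (rule power2_le_imp_le) (use u v in simp)
  have "(s - t)\<^sup>2 = (u * v - (1 + s * t)) * (u * v + (1 + s * t))"
    using uv by (simp add: power2_eq_square algebra_simps)
  also have "\<dots> \<le> (u * v - (1 + s * t)) * (2 * (u * v))"
    using le by (intro mult_left_mono) auto
  also have "\<dots> = u * v * ((u + v)\<^sup>2 - w\<^sup>2)"
    unfolding diff by simp
  also have "\<dots> = (u * v * (u + v - w)) * (u + v + w)"
    by (simp add: power2_eq_square algebra_simps)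
  also have "\<dots> \<le> (u * v * (u + v - w)) * (2 * (u + v))"
    using wle u v by (intro mult_left_mono) auto
  also have "\<dots> = (2 * (u * v)) * ((u + v) * (u + v - w))"
    by simp
  also have "\<dots> \<le> (u + v)\<^sup>2 * ((u + v) * (u + v - w))"
    using wle u v by (intro mult_right_mono) (auto simp: power2_sum)
  also have "\<dots> = (u + v) ^ 3 * (u + v - w)"
    by (simp add: power2_eq_square power3_eq_cube)
  finally show "(s - t)\<^sup>2 \<le> (\<psi> s + \<psi> t) ^ 3 * (\<psi> s + \<psi> t - 2 * \<psi> ((s + t) / 2))"
    by (simp add: u_def v_def w_def)
  show "0 \<le> \<psi> s + \<psi> t - 2 * \<psi> ((s + t) / 2)"
    using wle by (simp add: u_def v_def w_def)
qed

text \<open>A form of strict convexity that can be integrated: the right side is affine in the two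
  values and the midpoint gap. The three terms cover three regimes: the values sum to at least
  \<open>R\<close>, the points are \<open>\<delta>\<close>-close, or neither, where the cubic bound
  applies with \<open>R\<close> in place of the sum.\<close>

lemma min_dist_le_midpoint_gap:
  fixes s t R \<delta> :: real
  defines "\<psi> \<equiv> \<lambda>r::real. sqrt (1 + r\<^sup>2)"
  assumes "R > 0" "\<delta> > 0"
  shows "min 1 \<bar>s - t\<bar> \<le> (\<psi> s + \<psi> t) / R + \<delta>
           + R ^ 3 / \<delta> * (\<psi> s + \<psi> t - 2 * \<psi> ((s + t) / 2))"
proof -
  define S \<rho> where "S = \<psi> s + \<psi> t" and "\<rho> = \<psi> s + \<psi> t - 2 * \<psi> ((s + t) / 2)"
  have S: "S \<ge> 0" by (simp add: S_def \<psi>_def)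
  have \<rho>: "\<rho> \<ge> 0" "(s - t)\<^sup>2 \<le> S ^ 3 * \<rho>"
    using sqrt_one_plus_sq_strict_convex[of s t] by (simp_all add: S_def \<rho>_def \<psi>_def)
  have nn: "0 \<le> R ^ 3 / \<delta> * \<rho>" "0 \<le> S / R" using assms \<rho> S by simp_all
  consider "R \<le> S" | "S < R" "\<bar>s - t\<bar> \<le> \<delta>" | "S < R" "\<bar>s - t\<bar> > \<delta>" by linarith
  then have "min 1 \<bar>s - t\<bar> \<le> S / R + \<delta> + R ^ 3 / \<delta> * \<rho>"
  proof cases
    case 1
    then have "1 \<le> S / R" using assms by simp
    then show ?thesis using nn assms by linarith
  next
    case 2
    then show ?thesis using nn by linarith
  next
    case 3
    have "\<delta> * \<bar>s - t\<bar> \<le> \<bar>s - t\<bar> * \<bar>s - t\<bar>"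
      using 3 by (intro mult_right_mono) auto
    also have "\<dots> = (s - t)\<^sup>2" by (simp add: power2_eq_square)
    also have "\<dots> \<le> S ^ 3 * \<rho>" by (rule \<rho>)
    also have "\<dots> \<le> R ^ 3 * \<rho>"
      using 3 S \<rho> by (intro mult_right_mono power_mono) auto
    finally have "\<bar>s - t\<bar> \<le> R ^ 3 / \<delta> * \<rho>"
      using assms by (simp add: field_simps)
    then show ?thesis using nn assms by linarith
  qed
  then show ?thesis by (simp add: S_def \<rho>_def)
qed

section \<open>Integrability and almost sure convergence from summable increments\<close>

lemma integrable_sqrt_one_plus_sq:
  fixes f :: "'a \<Rightarrow> real"
  assumes "finite_measure N" and f: "integrable N f"
  shows "integrable N (\<lambda>x. sqrt (1 + (f x)\<^sup>2))"
proof (rule Bochner_Integration.integrable_bound)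
  interpret finite_measure N by fact
  show "integrable N (\<lambda>x. 1 + \<bar>f x\<bar>)" using f by auto
  have [measurable]: "f \<in> borel_measurable N" using f by auto
  show "(\<lambda>x. sqrt (1 + (f x)\<^sup>2)) \<in> borel_measurable N" by measurable
  have "sqrt (1 + r\<^sup>2) \<le> 1 + \<bar>r\<bar>" for r :: real
    by (rule real_le_lsqrt) (auto simp: power2_sum)
  then show "AE x in N. norm (sqrt (1 + (f x)\<^sup>2)) \<le> norm (1 + \<bar>f x\<bar>)"
    by auto
qed

text \<open>The terms of a summable series tend to 0, so the truncation at 1 is eventually inactive
  and the increments themselves are absolutely summable; then telescope.\<close>

lemma convergent_if_summable_min_increments:
  fixes f :: "nat \<Rightarrow> real"
  assumes "summable (\<lambda>n. min 1 \<bar>f (Suc n) - f n\<bar>)"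
  shows "convergent f"
proof -
  have "(\<lambda>n. min 1 \<bar>f (Suc n) - f n\<bar>) \<longlonglongrightarrow> 0"
    using assms by (rule summable_LIMSEQ_zero)
  then have "eventually (\<lambda>n. min 1 \<bar>f (Suc n) - f n\<bar> < 1) sequentially"
    by (rule order_tendstoD) simp
  then have "eventually (\<lambda>n. norm (f (Suc n) - f n) \<le> min 1 \<bar>f (Suc n) - f n\<bar>) sequentially"
    by (rule eventually_mono) (simp add: min_def split: if_splits)
  then have "summable (\<lambda>n. f (Suc n) - f n)"
    using assms by (rule summable_comparison_test_ev)
  then have "convergent (\<lambda>n. \<Sum>i<n. f (Suc i) - f i)"
    by (simp only: summable_iff_convergent)
  then have "convergent (\<lambda>n. f n - f 0)"
    by (simp only: sum_lessThan_telescope)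
  then show ?thesis
    by (simp only: convergent_diff_const_right_iff)
qed

text \<open>Borel-Cantelli in integral form: by monotone convergence the sum of all truncated
  increments has integral at most 2, hence is finite almost everywhere.\<close>

lemma AE_convergent_if_summable_increments:
  fixes f :: "nat \<Rightarrow> 'a \<Rightarrow> real"
  assumes [measurable]: "\<And>n. f n \<in> borel_measurable N"
    and int: "\<And>n. integrable N (\<lambda>x. min 1 \<bar>f (Suc n) x - f n x\<bar>)"
    and le: "\<And>n. (\<integral>x. min 1 \<bar>f (Suc n) x - f n x\<bar> \<partial>N) \<le> (1/2) ^ n"
  shows "AE x in N. convergent (\<lambda>n. f n x)"
proof -
  define d where "d n x = min 1 \<bar>f (Suc n) x - f n x\<bar>" for n x
  have [measurable]: "d n \<in> borel_measurable N" for n unfolding d_def by measurable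
  have "(\<integral>\<^sup>+x. (\<Sum>n. ennreal (d n x)) \<partial>N) = (\<Sum>n. \<integral>\<^sup>+x. ennreal (d n x) \<partial>N)"
    by (rule nn_integral_suminf) measurable
  also have "\<dots> \<le> (\<Sum>n. ennreal ((1/2) ^ n))"
  proof (intro suminf_le)
    show "(\<integral>\<^sup>+x. ennreal (d n x) \<partial>N) \<le> ennreal ((1/2) ^ n)" for n
    proof -
      have "integrable N (d n)" using int[of n] by (simp add: d_def[abs_def])
      then have "(\<integral>\<^sup>+x. ennreal (d n x) \<partial>N) = ennreal (\<integral>x. d n x \<partial>N)"
        by (rule nn_integral_eq_integral) (simp add: d_def)
      also have "\<dots> \<le> ennreal ((1/2) ^ n)"
        unfolding d_def by (rule ennreal_leI[OF le])
      finally show ?thesis .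
    qed
  qed (rule summableI)+
  also have "\<dots> = ennreal (\<Sum>n. (1/2) ^ n)"
    by (rule suminf_ennreal2) (simp, rule summable_geometric, simp)
  finally have "(\<integral>\<^sup>+x. (\<Sum>n. ennreal (d n x)) \<partial>N) \<noteq> \<infinity>"
    by (auto simp: top_unique)
  then have "AE x in N. (\<Sum>n. ennreal (d n x)) \<noteq> \<infinity>"
    by (rule nn_integral_noteq_infinite[rotated]) measurable
  then show ?thesis
  proof eventually_elim
    case (elim x)
    have "summable (\<lambda>n. d n x)"
    proof (rule summable_suminf_not_top)
      show "(\<Sum>n. ennreal (d n x)) \<noteq> \<top>" using elim by simp
    qed (simp add: d_def)
    then show ?case
      unfolding d_def by (rule convergent_if_summable_min_increments)
  qed
qed

section \<open>Minimisation over convex sets of integrable functions\<close>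

text \<open>The midpoint of two near-minimisers lies in \<open>D\<close> and so has value at least
  the infimum \<open>m\<close>. Hence their integrated midpoint gap is small, which makes them close
  in probability. A fast minimising sequence therefore converges almost surely.\<close>

lemma exists_minimal_smooth_norm:
  fixes D :: "('a \<Rightarrow> real) set" and N :: "'a measure"
  assumes fin: "finite_measure N" and ne: "D \<noteq> {}"
    and int: "\<And>d. d \<in> D \<Longrightarrow> integrable N d"
    and mid: "\<And>d d'. d \<in> D \<Longrightarrow> d' \<in> D \<Longrightarrow> (\<lambda>x. (d x + d' x) / 2) \<in> D"
    and lim: "\<And>ds d. (\<And>n. ds n \<in> D) \<Longrightarrow> d \<in> borel_measurable N \<Longrightarrow>
                (AE x in N. (\<lambda>n. ds n x) \<longlonglongrightarrow> d x) \<Longrightarrow> d \<in> D"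
  shows "\<exists>d\<in>D. \<forall>d'\<in>D. (\<integral>x. sqrt (1 + (d x)\<^sup>2) \<partial>N) \<le> (\<integral>x. sqrt (1 + (d' x)\<^sup>2) \<partial>N)"
proof -
  interpret finite_measure N by fact
  define \<psi> where "\<psi> r = sqrt (1 + r\<^sup>2)" for r :: real
  define J where "J d = (\<integral>x. \<psi> (d x) \<partial>N)" for d
  define m where "m = Inf (J ` D)"
  have \<psi>_meas [measurable]: "\<psi> \<in> borel_measurable borel"
    unfolding \<psi>_def[abs_def] by measurable
  have \<psi>_nn: "0 \<le> \<psi> r" for r by (simp add: \<psi>_def)
  have meas [measurable]: "d \<in> borel_measurable N" if "d \<in> D" for d
    using int[OF that] by auto
  have J_int: "integrable N (\<lambda>x. \<psi> (d x))" if "d \<in> D" for d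
    using integrable_sqrt_one_plus_sq[OF fin int[OF that]] by (simp add: \<psi>_def)
  have J_nn: "0 \<le> J d" for d unfolding J_def using \<psi>_nn by simp
  have bdd: "bdd_below (J ` D)" using J_nn by (auto intro!: bdd_belowI[of _ 0])
  have m_le: "m \<le> J d" if "d \<in> D" for d
    unfolding m_def using bdd that by (auto intro: cInf_lower)
  have m_nn: "0 \<le> m" unfolding m_def using ne J_nn by (auto intro: cInf_greatest)
  have approx: "\<exists>d\<in>D. J d < m + e" if "e > 0" for e
    using cInf_lessD[of "J ` D" "m + e"] ne that by (auto simp: m_def)
  have gap_int: "integrable N (\<lambda>x. min 1 \<bar>d x - d' x\<bar>)" if "d \<in> D" "d' \<in> D" for d d'
    using meas[OF that(1)] meas[OF that(2)] by (intro integrable_const_bound[of _ 1]) auto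
  have gap: "\<exists>e>0. \<forall>d\<in>D. \<forall>d'\<in>D. J d < m + e \<longrightarrow> J d' < m + e \<longrightarrow>
          (\<integral>x. min 1 \<bar>d x - d' x\<bar> \<partial>N) \<le> \<eta>" if \<eta>: "\<eta> > 0" for \<eta>
  proof -
    \<comment> \<open>The constants make each of the three integrated terms at most
      \<open>\<eta> / 3\<close>. Capping \<open>e\<close> by 1 bounds both values by
      \<open>q\<close>, and \<open>V + 1\<close> avoids division by zero when \<open>N\<close> has
      no mass.\<close>
    define V where "V = measure N (space N)"
    define q where "q = m + 1"
    define R where "R = 6 * q / \<eta>"
    define \<delta> where "\<delta> = \<eta> / (3 * (V + 1))"
    define e where "e = min 1 (\<eta> * \<delta> / (6 * R ^ 3))"
    have V: "V \<ge> 0" by (simp add: V_def)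
    have q: "q > 0" using m_nn by (simp add: q_def)
    have R: "R > 0" using q \<eta> by (simp add: R_def)
    have \<delta>: "\<delta> > 0" using V \<eta> by (simp add: \<delta>_def)
    have e: "e > 0" using R \<delta> \<eta> by (simp add: e_def)
    have "(\<integral>x. min 1 \<bar>d x - d' x\<bar> \<partial>N) \<le> \<eta>"
      if d: "d \<in> D" "d' \<in> D" "J d < m + e" "J d' < m + e" for d d'
    proof -
      note Js = J_int[OF d(1)] J_int[OF d(2)] J_int[OF mid[OF d(1,2)]]
      define G where "G x = (\<psi> (d x) + \<psi> (d' x)) / R + \<delta>
             + R ^ 3 / \<delta> * (\<psi> (d x) + \<psi> (d' x) - 2 * \<psi> ((d x + d' x) / 2))" for x
      have "(\<integral>x. min 1 \<bar>d x - d' x\<bar> \<partial>N) \<le> (\<integral>x. G x \<partial>N)"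
      proof (rule integral_mono)
        show "integrable N (\<lambda>x. min 1 \<bar>d x - d' x\<bar>)" using gap_int d by blast
        show "integrable N G" unfolding G_def[abs_def] using Js by auto
        show "min 1 \<bar>d x - d' x\<bar> \<le> G x" for x
          unfolding G_def \<psi>_def using min_dist_le_midpoint_gap[OF R \<delta>] by blast
      qed
      also have "\<dots> = (J d + J d') / R + \<delta> * V
          + R ^ 3 / \<delta> * (J d + J d' - 2 * J (\<lambda>x. (d x + d' x) / 2))"
        unfolding G_def[abs_def] J_def V_def using Js by (simp add: mult.commute)
      also have "\<dots> \<le> 2 * q / R + \<delta> * V + R ^ 3 / \<delta> * (2 * e)"
        using m_le[OF mid[OF d(1,2)]] d R \<delta>
        by (intro add_mono divide_right_mono mult_left_mono) (auto simp: e_def q_def)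
      also have "\<dots> \<le> \<eta> / 3 + \<eta> / 3 + \<eta> / 3"
      proof (intro add_mono)
        show "2 * q / R \<le> \<eta> / 3" using q \<eta> by (simp add: R_def field_simps)
        have "\<delta> * V \<le> \<delta> * (V + 1)" using \<delta> by simp
        also have "\<dots> = \<eta> / 3" using V by (simp add: \<delta>_def divide_simps)
        finally show "\<delta> * V \<le> \<eta> / 3" .
        have "R ^ 3 / \<delta> * (2 * e) \<le> R ^ 3 / \<delta> * (2 * (\<eta> * \<delta> / (6 * R ^ 3)))"
          using R \<delta> by (intro mult_left_mono) (auto simp: e_def)
        also have "\<dots> = \<eta> / 3" using R \<delta> by (simp add: field_simps)
        finally show "R ^ 3 / \<delta> * (2 * e) \<le> \<eta> / 3" .
      qed
      finally show ?thesis by simp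
    qed
    with e show ?thesis by blast
  qed
  then have "\<forall>k. \<exists>e>0. \<forall>d\<in>D. \<forall>d'\<in>D. J d < m + e \<longrightarrow> J d' < m + e \<longrightarrow>
          (\<integral>x. min 1 \<bar>d x - d' x\<bar> \<partial>N) \<le> (1/2) ^ k"
    by simp
  then obtain e :: "nat \<Rightarrow> real" where e: "\<And>k. e k > 0" and
    egap: "\<And>k d d'. d \<in> D \<Longrightarrow> d' \<in> D \<Longrightarrow> J d < m + e k \<Longrightarrow> J d' < m + e k \<Longrightarrow>
          (\<integral>x. min 1 \<bar>d x - d' x\<bar> \<partial>N) \<le> (1/2) ^ k"
    by metis
  \<comment> \<open>The running minimum puts \<open>ds k\<close> and \<open>ds (Suc k)\<close> both
    below the threshold \<open>e k\<close>, so consecutive terms are within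
    \<open>(1/2) ^ k\<close>; the part \<open>1 / Suc k\<close> forces the values to tend to
    \<open>m\<close>.\<close>
  define a where "a k = min (Min (e ` {..k})) (1 / Suc k)" for k
  have a_pos: "a k > 0" for k using e by (auto simp: a_def)
  have a_le: "a k \<le> e j" if "j \<le> k" for j k
    unfolding a_def using that by (intro min.coboundedI1 Min_le) auto
  have "\<forall>k. \<exists>d\<in>D. J d < m + a k" using approx a_pos by blast
  then obtain ds where ds: "\<And>k. ds k \<in> D" "\<And>k. J (ds k) < m + a k" by metis
  have [measurable]: "ds k \<in> borel_measurable N" for k using ds by (simp add: meas)
  have "AE x in N. convergent (\<lambda>k. ds k x)"
  proof (rule AE_convergent_if_summable_increments)
    show "(\<integral>x. min 1 \<bar>ds (Suc k) x - ds k x\<bar> \<partial>N) \<le> (1/2) ^ k" for k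
      using ds(2)[of k] ds(2)[of "Suc k"] a_le[of k k] a_le[of k "Suc k"] ds(1)
      by (intro egap) (auto intro: less_le_trans)
  qed (use ds gap_int in auto)
  \<comment> \<open>Where the sequence diverges, \<open>lim\<close> is an arbitrary value; this
    happens only on a null set and leaves \<open>d\<close> measurable.\<close>
  moreover define d where "d x = lim (\<lambda>k. ds k x)" for x
  have [measurable]: "d \<in> borel_measurable N" unfolding d_def[abs_def] by measurable
  ultimately have conv: "AE x in N. (\<lambda>k. ds k x) \<longlonglongrightarrow> d x"
    by (simp add: d_def convergent_LIMSEQ_iff)
  have d: "d \<in> D" by (rule lim[OF ds(1) _ conv]) measurable
  \<comment> \<open>Fatou's lemma for the nonnegative integrands gives the lower semicontinuity of
    \<open>J\<close> along the sequence, so \<open>d\<close> attains \<open>m\<close>.\<close>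
  have "ennreal (J d) = (\<integral>\<^sup>+x. ennreal (\<psi> (d x)) \<partial>N)"
    unfolding J_def using J_int[OF d] \<psi>_nn by (simp add: nn_integral_eq_integral)
  also have "\<dots> = (\<integral>\<^sup>+x. liminf (\<lambda>k. ennreal (\<psi> (ds k x))) \<partial>N)"
  proof (rule nn_integral_cong_AE, use conv in eventually_elim)
    case (elim x)
    then have "(\<lambda>k. ennreal (\<psi> (ds k x))) \<longlonglongrightarrow> ennreal (\<psi> (d x))"
      unfolding \<psi>_def by (intro tendsto_intros)
    then show ?case by (simp add: lim_imp_Liminf)
  qed
  also have "\<dots> \<le> liminf (\<lambda>k. \<integral>\<^sup>+x. ennreal (\<psi> (ds k x)) \<partial>N)"
    by (rule nn_integral_liminf) measurable
  also have "\<dots> = liminf (\<lambda>k. ennreal (J (ds k)))"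
    unfolding J_def using J_int[OF ds(1)] \<psi>_nn by (simp add: nn_integral_eq_integral)
  also have "\<dots> \<le> liminf (\<lambda>k. ennreal (m + 1 / Suc k))"
  proof (intro Liminf_mono always_eventually allI ennreal_leI)
    show "J (ds k) \<le> m + 1 / Suc k" for k using ds(2)[of k] by (simp add: a_def)
  qed
  also have "\<dots> = ennreal (m + 0)"
  proof (rule lim_imp_Liminf)
    have "(\<lambda>k. m + 1 / real (Suc k)) \<longlonglongrightarrow> m + 0"
      using lim_inverse_n' LIMSEQ_Suc by (intro tendsto_intros) blast
    then show "(\<lambda>k. ennreal (m + 1 / Suc k)) \<longlonglongrightarrow> ennreal (m + 0)" by (rule tendsto_ennrealI)
  qed simp
  finally have "J d \<le> m" using m_nn by simp
  then show ?thesis using d m_le unfolding J_def \<psi>_def by (meson order_trans)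
qed

text \<open>First-order condition: the gradient of \<open>\<lambda>r. sqrt (1 + r\<^sup>2)\<close> at the minimiser is
  bounded, so no duality theory for \<open>L\<^sup>1\<close> is needed to separate.\<close>
lemma exists_bounded_separator:
  fixes D :: "('a \<Rightarrow> real) set" and N :: "'a measure"
  assumes fin: "finite_measure N" and ne: "D \<noteq> {}"
    and int: "\<And>d. d \<in> D \<Longrightarrow> integrable N d"
    and conv: "\<And>d d' t. d \<in> D \<Longrightarrow> d' \<in> D \<Longrightarrow> 0 \<le> t \<Longrightarrow> t \<le> 1 \<Longrightarrow>
                (\<lambda>x. t * d x + (1 - t) * d' x) \<in> D"
    and lim: "\<And>ds d. (\<And>n. ds n \<in> D) \<Longrightarrow> d \<in> borel_measurable N \<Longrightarrow>
                (AE x in N. (\<lambda>n. ds n x) \<longlonglongrightarrow> d x) \<Longrightarrow> d \<in> D"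
  shows "\<exists>d\<in>D. \<forall>d'\<in>D. 0 \<le> (\<integral>x. (d' x - d x) * (d x / sqrt (1 + (d x)\<^sup>2)) \<partial>N)"
proof -
  interpret finite_measure N by fact
  define \<psi> where "\<psi> r = sqrt (1 + r\<^sup>2)" for r :: real
  have \<psi>_pos: "0 < \<psi> r" for r by (simp add: \<psi>_def add_pos_nonneg)
  have \<psi>_meas [measurable]: "\<psi> \<in> borel_measurable borel"
    unfolding \<psi>_def[abs_def] by measurable
  have grad_bound: "\<bar>r / \<psi> r\<bar> \<le> 1" for r
    unfolding \<psi>_def by (rule abs_div_sqrt_one_plus_sq_le)
  have mid: "(\<lambda>x. (d x + d' x) / 2) \<in> D" if "d \<in> D" "d' \<in> D" for d d'
    using conv[of d d' "1/2"] that by (simp add: field_simps)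
  have "\<exists>d\<in>D. \<forall>d'\<in>D. (\<integral>x. sqrt (1 + (d x)\<^sup>2) \<partial>N) \<le> (\<integral>x. sqrt (1 + (d' x)\<^sup>2) \<partial>N)"
    by (rule exists_minimal_smooth_norm[OF fin ne]) (fact int mid lim)+
  then obtain d where d: "d \<in> D"
    and min: "\<And>d'. d' \<in> D \<Longrightarrow> (\<integral>x. \<psi> (d x) \<partial>N) \<le> (\<integral>x. \<psi> (d' x) \<partial>N)"
    unfolding \<psi>_def by blast
  have J_int: "integrable N (\<lambda>x. \<psi> (d x))" if "d \<in> D" for d
    using integrable_sqrt_one_plus_sq[OF fin int[OF that]] by (simp add: \<psi>_def)
  have sep: "0 \<le> (\<integral>x. (d' x - d x) * (d x / \<psi> (d x)) \<partial>N)" if d': "d' \<in> D" for d'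
  proof -
    \<comment> \<open>Points on the segment from \<open>d\<close> to \<open>d'\<close> approaching
      \<open>d\<close>. Taking the gradient at \<open>w n\<close> rather than at \<open>d\<close>
      bounds the nonnegative increment of the functional from above; as the gradient is bounded by
      1, dominated convergence with bound \<open>\<bar>d' x - d x\<bar>\<close> then moves it to
      \<open>d\<close>.\<close>
    define w where "w n x = d x + (1 / Suc n) * (d' x - d x)" for n :: nat and x
    have w: "w n \<in> D" for n
    proof -
      have "(\<lambda>x. (1 / Suc n) * d' x + (1 - 1 / Suc n) * d x) \<in> D"
        using d d' by (intro conv) auto
      also have "(\<lambda>x. (1 / Suc n) * d' x + (1 - 1 / Suc n) * d x) = w n"
        unfolding w_def by (rule ext) (simp add: algebra_simps diff_divide_distrib)
      finally show ?thesis .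
    qed
    note [measurable] = borel_measurable_integrable[OF int[OF w]]
      borel_measurable_integrable[OF int[OF d]] borel_measurable_integrable[OF int[OF d']]
    have dom: "integrable N (\<lambda>x. \<bar>d' x - d x\<bar>)"
      by (intro integrable_abs Bochner_Integration.integrable_diff int d d')
    have bnd: "norm ((d' x - d x) * (w n x / \<psi> (w n x))) \<le> \<bar>d' x - d x\<bar>" for n x
      using mult_left_mono[OF grad_bound[of "w n x"], of "\<bar>d' x - d x\<bar>"]
      by (simp add: abs_mult)
    have wint: "integrable N (\<lambda>x. (d' x - d x) * (w n x / \<psi> (w n x)))" for n
      by (rule Bochner_Integration.integrable_bound[OF dom], measurable) (use bnd in auto)
    have ge: "0 \<le> (\<integral>x. (d' x - d x) * (w n x / \<psi> (w n x)) \<partial>N)" for n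
    proof -
      have "0 \<le> (\<integral>x. \<psi> (w n x) \<partial>N) - (\<integral>x. \<psi> (d x) \<partial>N)"
        using min[OF w] by simp
      also have "\<dots> = (\<integral>x. \<psi> (w n x) - \<psi> (d x) \<partial>N)"
        using J_int[OF w] J_int[OF d] by simp
      also have "\<dots> \<le> (\<integral>x. (1 / Suc n) * ((d' x - d x) * (w n x / \<psi> (w n x))) \<partial>N)"
      proof (rule integral_mono)
        show "\<psi> (w n x) - \<psi> (d x) \<le> (1 / Suc n) * ((d' x - d x) * (w n x / \<psi> (w n x)))" for x
        proof -
          have "w n x - d x = (1 / Suc n) * (d' x - d x)" by (simp add: w_def)
          then show ?thesis
            using sqrt_one_plus_sq_gradient[of "w n x" "d x"]
            unfolding \<psi>_def by (simp only: mult.assoc)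
        qed
      qed (intro integrable_mult_right wint Bochner_Integration.integrable_diff J_int w d)+
      also have "\<dots> = (1 / Suc n) * (\<integral>x. (d' x - d x) * (w n x / \<psi> (w n x)) \<partial>N)"
        by (rule integral_mult_right_zero)
      finally show ?thesis by (simp add: zero_le_divide_iff)
    qed
    have "(\<lambda>n. \<integral>x. (d' x - d x) * (w n x / \<psi> (w n x)) \<partial>N)
          \<longlonglongrightarrow> (\<integral>x. (d' x - d x) * (d x / \<psi> (d x)) \<partial>N)"
    proof (rule integral_dominated_convergence[OF _ _ dom])
      have "(\<lambda>n. w n x) \<longlonglongrightarrow> d x + 0 * (d' x - d x)" for x
        unfolding w_def
        by (rule tendsto_add[OF tendsto_const tendsto_mult[OF LIMSEQ_Suc[OF lim_inverse_n'] tendsto_const]])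
      then have "(\<lambda>n. (d' x - d x) * (w n x / \<psi> (w n x))) \<longlonglongrightarrow> (d' x - d x) * (d x / \<psi> (d x))" for x
        using \<psi>_pos[of "d x"] unfolding \<psi>_def by (intro tendsto_intros) auto
      then show "AE x in N. (\<lambda>n. (d' x - d x) * (w n x / \<psi> (w n x)))
          \<longlonglongrightarrow> (d' x - d x) * (d x / \<psi> (d x))" by simp
    qed (measurable, use bnd in auto)
    then show ?thesis by (rule LIMSEQ_le_const) (use ge in blast)
  qed
  show ?thesis by (intro bexI[of _ d] ballI sep[unfolded \<psi>_def] d)
qed

section \<open>Convergence in probability and weak topologies\<close>

text \<open>Truncating the distance at 1 turns convergence in probability into
  \<open>L\<^sup>1\<close> convergence: the mean of the truncated distance is at most
  \<open>e / 2\<close> plus the probability of exceeding \<open>e / 2\<close>. An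
  \<open>L\<^sup>1\<close> null sequence has an almost surely null subsequence.\<close>

lemma (in prob_space) conv_in_prob_AE_subseq:
  assumes [measurable]: "\<And>n. fs n \<in> borel_measurable M" "f \<in> borel_measurable M"
    and conv: "conv_in_prob M fs f"
  obtains r where "strict_mono r" "AE x in M. (\<lambda>n. fs (r n) x) \<longlonglongrightarrow> f x"
proof -
  define u where "u n x = min 1 \<bar>fs n x - f x\<bar>" for n x
  have [measurable]: "u n \<in> borel_measurable M" for n unfolding u_def by measurable
  have u_int: "integrable M (u n)" for n
    by (rule integrable_const_bound[of _ 1]) (auto simp: u_def)
  have "(\<lambda>n. \<integral>x. norm (u n x) \<partial>M) \<longlonglongrightarrow> 0"
  proof (rule tendstoI)
    fix e :: real assume e: "e > 0"
    define A where "A n = {x \<in> space M. e / 2 < \<bar>fs n x - f x\<bar>}" for n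
    have [measurable]: "A n \<in> sets M" for n unfolding A_def by measurable
    have "e / 2 > 0" using e by simp
    then have "(\<lambda>n. prob (A n)) \<longlonglongrightarrow> 0"
      using conv unfolding conv_in_prob_def A_def by blast
    then have "eventually (\<lambda>n. prob (A n) < e / 2) sequentially"
      using e by (intro order_tendstoD) auto
    then show "eventually (\<lambda>n. dist (\<integral>x. norm (u n x) \<partial>M) 0 < e) sequentially"
    proof eventually_elim
      case (elim n)
      have "norm (u n x) \<le> e / 2 + indicator (A n) x" if "x \<in> space M" for x
      proof (cases "x \<in> A n")
        case False
        then have "\<bar>fs n x - f x\<bar> \<le> e / 2" using that by (auto simp: A_def)
        then have "min 1 \<bar>fs n x - f x\<bar> \<le> e / 2" by (rule min.coboundedI2)
        then show ?thesis using False by (simp add: u_def)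
      qed (use e in \<open>auto simp: u_def\<close>)
      then have "(\<integral>x. norm (u n x) \<partial>M) \<le> (\<integral>x. e / 2 + indicator (A n) x \<partial>M)"
        using u_int[of n]
        by (intro integral_mono Bochner_Integration.integrable_add integrable_const)
           (auto simp: emeasure_eq_measure)
      also have "\<dots> = e / 2 + prob (A n)" by (simp add: emeasure_eq_measure prob_space)
      finally show ?case using elim by (simp add: dist_real_def)
    qed
  qed
  then obtain r where r: "strict_mono r" and ae: "AE x in M. (\<lambda>n. u (r n) x) \<longlonglongrightarrow> 0"
    using tendsto_L1_AE_subseq[of M u, OF u_int] by blast
  from ae have "AE x in M. (\<lambda>n. fs (r n) x) \<longlonglongrightarrow> f x"
  proof eventually_elim
    case (elim x)
    then have "eventually (\<lambda>n. u (r n) x < 1) sequentially"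
      by (rule order_tendstoD) simp
    then have "eventually (\<lambda>n. u (r n) x = \<bar>fs (r n) x - f x\<bar>) sequentially"
      by eventually_elim (auto simp: u_def min_def split: if_splits)
    with elim have "(\<lambda>n. \<bar>fs (r n) x - f x\<bar>) \<longlonglongrightarrow> 0"
      by (rule Lim_transform_eventually)
    then have "(\<lambda>n. fs (r n) x - f x) \<longlonglongrightarrow> 0"
      by (rule tendsto_rabs_zero_cancel)
    then show ?case by (rule LIM_zero_cancel)
  qed
  with r show ?thesis by (rule that)
qed

lemma (in prob_space) conv_in_prob_if_AE:
  assumes [measurable]: "\<And>n. fs n \<in> borel_measurable M" "f \<in> borel_measurable M"
    and ae: "AE x in M. (\<lambda>n. fs n x) \<longlonglongrightarrow> f x"
  shows "conv_in_prob M fs f"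
  unfolding conv_in_prob_def
proof (intro allI impI)
  fix e :: real assume e: "e > 0"
  define A where "A n = {x \<in> space M. e < \<bar>fs n x - f x\<bar>}" for n
  have [measurable]: "A n \<in> sets M" for n unfolding A_def by measurable
  have "(\<lambda>n. \<integral>x. indicator (A n) x \<partial>M) \<longlonglongrightarrow> (\<integral>x. (0::real) \<partial>M)"
  proof (rule integral_dominated_convergence[where w = "\<lambda>_. 1"])
    show "AE x in M. (\<lambda>n. indicator (A n) x) \<longlonglongrightarrow> (0::real)"
      using ae
    proof eventually_elim
      case (elim x)
      then have "eventually (\<lambda>n. dist (fs n x) (f x) < e) sequentially"
        using e by (rule tendstoD)
      then have "eventually (\<lambda>n. indicator (A n) x = (0::real)) sequentially"
        by eventually_elim (auto simp: A_def dist_real_def)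
      then show ?case by (rule tendsto_eventually)
    qed
  qed (simp_all split: split_indicator)
  then show "(\<lambda>n. prob {x \<in> space M. e < \<bar>fs n x - f x\<bar>}) \<longlonglongrightarrow> 0"
    by (simp add: A_def)
qed

section \<open>Weak topologies of solid dual spaces\<close>

lemma topspace_weak_top [simp]: "topspace (weak_top M E F) = E"
  unfolding weak_top_def topspace_pullback_topology by auto

lemma continuous_map_pairing:
  assumes "g \<in> F"
  shows "continuous_map (weak_top M E F) euclideanreal (\<lambda>f. pairing M f g)"
proof -
  have "continuous_map (weak_top M E F) euclideanreal
          ((\<lambda>u. u g) \<circ> (\<lambda>f. restrict (\<lambda>g. pairing M f g) F))"
    unfolding weak_top_def using assms
    by (intro continuous_map_pullback continuous_map_product_projection)
  then show ?thesis using assms by (simp add: o_def)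
qed

lemma continuous_map_into_weak_top:
  assumes "T ` topspace X \<subseteq> E"
    and "\<And>g. g \<in> F \<Longrightarrow> continuous_map X euclideanreal (\<lambda>f. pairing M (T f) g)"
  shows "continuous_map X (weak_top M E F) T"
  unfolding weak_top_def
proof (rule continuous_map_pullback')
  show "continuous_map X (product_topology (\<lambda>_. euclideanreal) F)
          ((\<lambda>f. restrict (\<lambda>g. pairing M f g) F) \<circ> T)"
    using assms(2) by (auto simp add: continuous_map_componentwise o_def restrict_def extensional_def)
  show "topspace X \<subseteq> T -` E" using assms(1) by (rule image_subset_iff_subset_vimage[THEN iffD1])
qed

text \<open>The properties of an inducing space \<open>F\<close> on which both closedness arguments
  rest. Integrability of the products guarantees that \<open>pairing\<close> is a genuine integral
  and not the default value 0, hence additive.\<close>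

definition integrable_dual :: "'a measure \<Rightarrow> ('a \<Rightarrow> real) set \<Rightarrow> ('a \<Rightarrow> real) set \<Rightarrow> bool" where
  "integrable_dual M E F \<longleftrightarrow> E \<subseteq> borel_measurable M \<and> F \<subseteq> borel_measurable M \<and>
     (\<forall>f\<in>E. \<forall>g\<in>F. integrable M (\<lambda>x. f x * g x)) \<and>
     solid M F \<and> (\<exists>h\<in>F. AE x in M. 0 < h x)"

lemma integrable_dualD:
  assumes "integrable_dual M E F"
  shows "f \<in> E \<Longrightarrow> f \<in> borel_measurable M" "g \<in> F \<Longrightarrow> g \<in> borel_measurable M"
    "f \<in> E \<Longrightarrow> g \<in> F \<Longrightarrow> integrable M (\<lambda>x. f x * g x)"
  using assms unfolding integrable_dual_def by blast+

lemma integrable_dual_solid: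
  assumes "integrable_dual M E F" "g \<in> F" "h \<in> borel_measurable M"
    and "\<And>x. \<bar>h x\<bar> \<le> \<bar>g x\<bar>"
  shows "h \<in> F"
proof -
  have "solid M F" using assms(1) unfolding integrable_dual_def by blast
  moreover have "AE x in M. \<bar>h x\<bar> \<le> \<bar>g x\<bar>" using assms(4) by (rule AE_I2)
  ultimately show ?thesis using assms(2,3) unfolding solid_def by blast
qed

text \<open>Truncating a strictly positive element to \<open>[0, 1]\<close> stays in
  \<open>F\<close> by solidity. The bound 1 makes the weighted measure finite and lets constants
  dominate in limit arguments.\<close>

lemma integrable_dual_weight:
  assumes "integrable_dual M E F"
  obtains h where "h \<in> F" "AE x in M. 0 < h x" "\<And>x. 0 \<le> h x" "\<And>x. h x \<le> 1"
proof -
  obtain g where g: "g \<in> F" "AE x in M. 0 < g x"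
    using assms unfolding integrable_dual_def by blast+
  have [measurable]: "g \<in> borel_measurable M" using assms g by (simp add: integrable_dualD)
  define h where "h x = max 0 (min 1 (g x))" for x
  have [measurable]: "h \<in> borel_measurable M" unfolding h_def[abs_def] by measurable
  show ?thesis
  proof
    show "h \<in> F" by (rule integrable_dual_solid[OF assms g(1)]) (auto simp: h_def)
    show "AE x in M. 0 < h x" using g(2) by eventually_elim (auto simp: h_def)
  qed (auto simp: h_def)
qed

text \<open>A Mazur-type theorem. The measure \<open>N\<close> with density \<open>h\<close> has the
  same null sets as \<open>M\<close> and makes every element of \<open>E\<close> integrable, so the
  minimisation result applies to the translate of \<open>C\<close> by a point \<open>f\<close> of
  its weak closure.\<close>

lemma (in prob_space) closedin_weak_top_convex:
  assumes dual: "integrable_dual M E F" and CE: "C \<subseteq> E" and convex: "convex_fset C"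
    and lim: "\<And>cs c. (\<And>n. cs n \<in> C) \<Longrightarrow> c \<in> borel_measurable M \<Longrightarrow>
                (AE x in M. (\<lambda>n. cs n x) \<longlonglongrightarrow> c x) \<Longrightarrow> c \<in> C"
  shows "closedin (weak_top M E F) C"
proof -
  let ?W = "weak_top M E F"
  note meas = integrable_dualD[OF dual]
  obtain h where h: "h \<in> F" "AE x in M. 0 < h x" "\<And>x. 0 \<le> h x" "\<And>x. h x \<le> 1"
    using integrable_dual_weight[OF dual] by blast
  have h_meas [measurable]: "h \<in> borel_measurable M" using h meas by blast
  define N where "N = density M h"
  have AE_N: "(AE x in N. P x) \<longleftrightarrow> (AE x in M. P x)" for P
  proof -
    have "(AE x in N. P x) \<longleftrightarrow> (AE x in M. 0 < h x \<longrightarrow> P x)"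
      unfolding N_def by (subst AE_density) auto
    also have "\<dots> \<longleftrightarrow> (AE x in M. P x)" using h(2) by (auto elim: eventually_elim2)
    finally show ?thesis .
  qed
  have meas_N: "borel_measurable N = (borel_measurable M :: ('a \<Rightarrow> real) set)"
    by (auto simp: N_def)
  have fin: "finite_measure N"
  proof (rule finite_measureI)
    have "emeasure N (space N) = (\<integral>\<^sup>+x. ennreal (h x) \<partial>M)"
      by (simp add: N_def emeasure_density cong: nn_integral_cong)
    also have "\<dots> \<le> (\<integral>\<^sup>+x. 1 \<partial>M)"
      using h by (intro nn_integral_mono) auto
    also have "\<dots> = 1" by (simp add: emeasure_space_1)
    finally show "emeasure N (space N) \<noteq> \<infinity>" by (auto simp: top_unique)
  qed
  have "f \<in> C" if f: "f \<in> ?W closure_of C" for f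
  proof -
    have fE: "f \<in> E" using f closure_of_subset_topspace[of ?W C] by auto
    have f_meas [measurable]: "f \<in> borel_measurable M" using fE meas by blast
    have C_meas: "c \<in> borel_measurable M" if "c \<in> C" for c using CE that meas by blast
    define D where "D = (\<lambda>c x. c x - f x) ` C"
    have "\<exists>d\<in>D. \<forall>d'\<in>D. 0 \<le> (\<integral>x. (d' x - d x) * (d x / sqrt (1 + (d x)\<^sup>2)) \<partial>N)"
    proof (rule exists_bounded_separator[OF fin])
      show "D \<noteq> {}" using f by (auto simp: D_def)
      show "integrable N d" if d: "d \<in> D" for d
      proof -
        obtain c where c: "c \<in> C" "d = (\<lambda>x. c x - f x)"
          using d unfolding D_def by blast
        note [measurable] = C_meas[OF c(1)]
        have "integrable M (\<lambda>x. c x * h x - f x * h x)"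
          using c CE fE h meas by (intro Bochner_Integration.integrable_diff) auto
        then have "integrable M (\<lambda>x. h x *\<^sub>R d x)"
          by (simp add: c(2) algebra_simps)
        then show ?thesis unfolding N_def using h(3) c(2)
          by (subst integrable_density) auto
      qed
      show "(\<lambda>x. t * d x + (1 - t) * d' x) \<in> D"
        if d: "d \<in> D" "d' \<in> D" and t: "0 \<le> t" "t \<le> 1" for d d' t
      proof -
        obtain c c' where c: "c \<in> C" "d = (\<lambda>x. c x - f x)" "c' \<in> C" "d' = (\<lambda>x. c' x - f x)"
          using d unfolding D_def by blast
        have "(\<lambda>x. t * c x + (1 - t) * c' x) \<in> C"
          using convex c t unfolding convex_fset_def by blast
        then show ?thesis unfolding D_def
          by (rule rev_image_eqI) (simp add: c fun_eq_iff algebra_simps)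
      qed
      show "d \<in> D" if ds: "\<And>n. ds n \<in> D" and d: "d \<in> borel_measurable N"
        and ae: "AE x in N. (\<lambda>n. ds n x) \<longlonglongrightarrow> d x" for ds d
      proof -
        have "\<forall>n. \<exists>c. c \<in> C \<and> ds n = (\<lambda>x. c x - f x)"
          using ds unfolding D_def by blast
        then obtain cs where cs: "\<And>n. cs n \<in> C" "\<And>n. ds n = (\<lambda>x. cs n x - f x)" by metis
        have [measurable]: "d \<in> borel_measurable M" using d meas_N by simp
        have "(\<lambda>x. d x + f x) \<in> C"
        proof (rule lim[OF cs(1)])
          show "AE x in M. (\<lambda>n. cs n x) \<longlonglongrightarrow> d x + f x"
            using ae unfolding AE_N
          proof eventually_elim
            case (elim x)
            then have "(\<lambda>n. ds n x + f x) \<longlonglongrightarrow> d x + f x" by (intro tendsto_intros)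
            then show ?case by (simp add: cs(2))
          qed
        qed measurable
        then show ?thesis unfolding D_def by (rule rev_image_eqI) auto
      qed
    qed
    then obtain c where c: "c \<in> C" and
      sep: "\<And>c'. c' \<in> C \<Longrightarrow> 0 \<le> (\<integral>x. (c' x - c x) * ((c x - f x) / sqrt (1 + (c x - f x)\<^sup>2)) \<partial>N)"
      unfolding D_def by auto
    have c_meas [measurable]: "c \<in> borel_measurable M" using C_meas c .
    \<comment> \<open>\<open>k\<close> is the gradient at the minimiser. It is bounded by 1, so its
      product with \<open>h\<close> is dominated by \<open>h\<close> and is a weakly continuous
      functional from \<open>F\<close>.\<close>
    define k where "k x = (c x - f x) / sqrt (1 + (c x - f x)\<^sup>2)" for x
    define g where "g x = k x * h x" for x
    have k_meas [measurable]: "k \<in> borel_measurable M" unfolding k_def[abs_def] by measurable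
    have [measurable]: "g \<in> borel_measurable M" unfolding g_def[abs_def] by measurable
    have "\<bar>k x\<bar> \<le> 1" for x
      unfolding k_def by (rule abs_div_sqrt_one_plus_sq_le)
    then have "\<bar>g x\<bar> \<le> \<bar>h x\<bar>" for x
      using h(3)[of x] mult_right_mono[of "\<bar>k x\<bar>" 1 "h x"] by (simp add: g_def abs_mult)
    then have gF: "g \<in> F"
      by (intro integrable_dual_solid[OF dual h(1)]) auto
    have diff: "pairing M c' g - pairing M c g = (\<integral>x. (c' x - c x) * k x \<partial>N)"
      if "c' \<in> E" for c'
    proof -
      have [measurable]: "c' \<in> borel_measurable M" using that meas by blast
      have "pairing M c' g - pairing M c g = (\<integral>x. c' x * g x - c x * g x \<partial>M)"
        unfolding pairing_def using that c CE gF meas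
        by (intro Bochner_Integration.integral_diff[symmetric]) auto
      also have "\<dots> = (\<integral>x. h x *\<^sub>R ((c' x - c x) * k x) \<partial>M)"
        by (rule Bochner_Integration.integral_cong) (simp_all add: g_def algebra_simps)
      also have "\<dots> = (\<integral>x. (c' x - c x) * k x \<partial>N)"
        unfolding N_def using h(3) by (subst integral_density) auto
      finally show ?thesis .
    qed
    \<comment> \<open>By the first-order condition this weakly closed half-space contains
      \<open>C\<close>, hence also \<open>f\<close>.\<close>
    have "closedin ?W {y \<in> topspace ?W. pairing M y g \<in> {pairing M c g..}}"
      using continuous_map_pairing[OF gF] by (rule closedin_continuous_map_preimage) auto
    moreover have "C \<subseteq> {y \<in> topspace ?W. pairing M y g \<in> {pairing M c g..}}"
    proof
      fix c' assume c': "c' \<in> C"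
      have "0 \<le> pairing M c' g - pairing M c g"
        using sep[OF c'] c' CE by (subst diff) (auto simp: k_def)
      then show "c' \<in> {y \<in> topspace ?W. pairing M y g \<in> {pairing M c g..}}"
        using c' CE by auto
    qed
    ultimately have "f \<in> {y \<in> topspace ?W. pairing M y g \<in> {pairing M c g..}}"
      using f closure_of_minimal by blast
    then have "pairing M c g - pairing M f g \<le> 0" by simp
    moreover have "pairing M c g - pairing M f g = (\<integral>x. c x * g x - f x * g x \<partial>M)"
      unfolding pairing_def using fE c CE gF meas
      by (intro Bochner_Integration.integral_diff[symmetric]) auto
    ultimately have le: "(\<integral>x. c x * g x - f x * g x \<partial>M) \<le> 0" by (simp only:)
    have int: "integrable M (\<lambda>x. c x * g x - f x * g x)"
      using fE c CE gF meas by (intro Bochner_Integration.integrable_diff) auto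
    \<comment> \<open>The integrand has a sign because the gradient at \<open>c - f\<close> has the
      sign of \<open>c - f\<close>. An integral that is at most 0 then forces it to vanish almost
      everywhere.\<close>
    have nn: "0 \<le> c x * g x - f x * g x" for x
    proof -
      have "c x * g x - f x * g x = (c x - f x) * g x" by (simp add: left_diff_distrib)
      also have "\<dots> = (c x - f x)\<^sup>2 / sqrt (1 + (c x - f x)\<^sup>2) * h x"
        by (simp add: g_def k_def power2_eq_square)
      finally show ?thesis using h(3)[of x] by (simp add: divide_nonneg_nonneg)
    qed
    then have "0 \<le> (\<integral>x. c x * g x - f x * g x \<partial>M)"
      by (rule Bochner_Integration.integral_nonneg)
    with le have "(\<integral>x. c x * g x - f x * g x \<partial>M) = 0" by (rule antisym)
    then have "AE x in M. c x * g x - f x * g x = 0"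
      using integral_nonneg_eq_0_iff_AE[OF int] nn by simp
    \<comment> \<open>\<open>f\<close> and \<open>c\<close> agree only almost everywhere; closedness
      under almost sure limits, used with a constant sequence, passes from the representative
      \<open>c\<close> to \<open>f\<close>.\<close>
    then have "AE x in M. (\<lambda>n. c x) \<longlonglongrightarrow> f x"
      using h(2)
    proof eventually_elim
      case (elim x)
      have "sqrt (1 + (c x - f x)\<^sup>2) > 0" by (simp add: add_pos_nonneg)
      moreover have "(c x - f x) * g x = 0" using elim(1) by (simp add: left_diff_distrib)
      ultimately have "c x = f x" using elim(2) unfolding g_def k_def by simp
      then show ?case by simp
    qed
    show ?thesis
      by (rule lim[of "\<lambda>_. c", OF c f_meas]) fact
  qed
  then have "?W closure_of C \<subseteq> C" by (rule subsetI)
  then show ?thesis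
    using CE closure_of_subset_eq[of C ?W] by simp
qed

text \<open>A weak cluster point must have the same pairings as the almost sure limit against enough
  test functions. Since pairings do not see null sets, the limit is recovered only up to almost
  everywhere equality.\<close>

lemma (in prob_space) AE_limit_in_weakly_compact:
  assumes dual: "integrable_dual M E F" and compact: "compactin (weak_top M E F) C"
    and gs: "\<And>n. gs n \<in> C" and fE: "f \<in> E"
    and ae: "AE x in M. (\<lambda>n. gs n x) \<longlonglongrightarrow> f x"
  shows "\<exists>f'\<in>C. AE x in M. f' x = f x"
proof -
  note meas = integrable_dualD[OF dual]
  have CE: "C \<subseteq> E" using compactin_subset_topspace[OF compact] by simp
  define X where "X = subtopology (weak_top M E F) C"
  have topX: "topspace X = C" using CE by (auto simp: X_def)
  \<comment> \<open>Weak compactness need not yield convergent subsequences, so a cluster point is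
    taken from the nested closures of the tails.\<close>
  define T where "T n = X closure_of (gs ` {n..})" for n
  have "(\<Inter>n. T n) \<noteq> {}"
  proof (rule compact_space_imp_nest)
    show "compact_space X" unfolding X_def using compact by (rule compact_space_subtopology)
    show "closedin X (T n)" for n by (simp add: T_def)
    have "gs n \<in> T n" for n
      using closure_of_subset[of "gs ` {n..}" X] gs topX by (auto simp: T_def)
    then show "T n \<noteq> {}" for n by blast
    show "decseq T" unfolding T_def by (intro antimonoI closure_of_mono) auto
  qed
  then obtain f' where f': "\<And>n. f' \<in> T n" by blast
  have f'C: "f' \<in> C" using f'[of 0] closure_of_subset_topspace[of X] topX by (auto simp: T_def)
  have pairing_eq: "pairing M f' g = pairing M f g"
    if g: "g \<in> F" and lim: "(\<lambda>n. pairing M (gs n) g) \<longlonglongrightarrow> pairing M f g" for g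
  proof -
    have "dist (pairing M f' g) (pairing M f g) \<le> e" if e: "e > 0" for e
    proof -
      obtain n where n: "\<And>m. n \<le> m \<Longrightarrow> dist (pairing M (gs m) g) (pairing M f g) < e"
        using lim e by (auto simp: lim_sequentially)
      \<comment> \<open>From index \<open>n\<close> on, the sequence lies in the closed set where
        the pairing is within \<open>e\<close> of its limit; so do \<open>T n\<close> and therefore
        \<open>f'\<close>.\<close>
      have "continuous_map X euclideanreal (\<lambda>y. pairing M y g)"
        unfolding X_def using g by (intro continuous_map_from_subtopology continuous_map_pairing)
      then have "closedin X {y \<in> topspace X. pairing M y g \<in> cball (pairing M f g) e}"
        by (rule closedin_continuous_map_preimage) auto
      then have "T n \<subseteq> {y \<in> topspace X. pairing M y g \<in> cball (pairing M f g) e}"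
        unfolding T_def using gs n topX
        by (intro closure_of_minimal) (auto simp: dist_commute less_imp_le)
      then show ?thesis using f'[of n] by (auto simp: dist_commute)
    qed
    then show ?thesis by (metis dense_ge dist_le_zero_iff)
  qed
  obtain h where h: "h \<in> F" "AE x in M. 0 < h x" "\<And>x. 0 \<le> h x" "\<And>x. h x \<le> 1"
    using integrable_dual_weight[OF dual] by blast
  have [measurable]: "h \<in> borel_measurable M" "f \<in> borel_measurable M" "f' \<in> borel_measurable M"
    "gs n \<in> borel_measurable M" for n
    using h fE f'C gs CE meas by blast+
  \<comment> \<open>On \<open>A k\<close> the sequence is dominated by \<open>k\<close>. Convergent
    real sequences are bounded, so almost every point lies in some \<open>A k\<close>.\<close>
  define A where "A k = {x \<in> space M. \<forall>n. \<bar>gs n x\<bar> \<le> real k}" for k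
  have [measurable]: "A k \<in> sets M" for k unfolding A_def by measurable
  have eq_on: "AE x in M. x \<in> A k \<longrightarrow> f' x = f x" for k
  proof -
    \<comment> \<open>The sign turns the difference of the pairings into the integral of
      \<open>\<bar>f' x - f x\<bar> * h x\<close> over \<open>A k\<close>.\<close>
    define g where "g x = h x * indicator (A k) x * sgn (f' x - f x)" for x
    have [measurable]: "g \<in> borel_measurable M" unfolding g_def[abs_def] by measurable
    have gF: "g \<in> F"
      by (rule integrable_dual_solid[OF dual h(1)])
         (use h(3) in \<open>auto simp: g_def abs_mult sgn_if indicator_def\<close>)
    have "(\<lambda>n. \<integral>x. gs n x * g x \<partial>M) \<longlonglongrightarrow> (\<integral>x. f x * g x \<partial>M)"
    proof (rule integral_dominated_convergence[where w = "\<lambda>_. real k"])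
      show "AE x in M. (\<lambda>n. gs n x * g x) \<longlonglongrightarrow> f x * g x"
        using ae by eventually_elim (intro tendsto_intros)
      have "\<bar>gs n x\<bar> * \<bar>g x\<bar> \<le> real k * 1" for n x
      proof (cases "x \<in> A k")
        case True
        then show ?thesis using h(3,4)[of x]
          by (intro mult_mono) (auto simp: A_def g_def abs_mult sgn_if)
      qed (simp add: g_def)
      then show "AE x in M. norm (gs n x * g x) \<le> real k" for n by (simp add: abs_mult)
    qed auto
    then have "pairing M f' g = pairing M f g"
      using pairing_eq[OF gF] by (simp add: pairing_def)
    moreover have int: "integrable M (\<lambda>x. f' x * g x)" "integrable M (\<lambda>x. f x * g x)"
      using f'C CE fE gF meas by auto
    ultimately have "(\<integral>x. f' x * g x - f x * g x \<partial>M) = 0"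
      by (simp add: pairing_def)
    moreover have nn: "f' x * g x - f x * g x = \<bar>f' x - f x\<bar> * h x * indicator (A k) x" for x
      by (simp add: g_def sgn_if algebra_simps)
    moreover have "AE x in M. 0 \<le> f' x * g x - f x * g x"
      using h(3) by (simp add: nn)
    ultimately have "AE x in M. f' x * g x - f x * g x = 0"
      using integral_nonneg_eq_0_iff_AE[OF Bochner_Integration.integrable_diff[OF int]] by blast
    then show ?thesis using h(2)
      by eventually_elim (auto simp: nn indicator_def)
  qed
  then have "AE x in M. \<forall>k. x \<in> A k \<longrightarrow> f' x = f x"
    by (intro AE_all_countable[THEN iffD2] allI)
  then have "AE x in M. f' x = f x" using ae AE_space
  proof eventually_elim
    case (elim x)
    then have "Bseq (\<lambda>n. gs n x)" by (intro convergent_imp_Bseq) (auto simp: convergent_def)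
    then obtain B where "\<And>n. \<bar>gs n x\<bar> \<le> B" by (auto simp: Bseq_def)
    moreover obtain k where "B \<le> real k" using real_arch_simple by blast
    ultimately have "x \<in> A k" using elim(3) by (auto simp: A_def intro: order_trans)
    then show ?case using elim(1) by blast
  qed
  then show ?thesis using f'C by (rule bexI)
qed

section \<open>Scaled copies of a closed absolutely convex set\<close>

lemma scale_set_iff:
  assumes "l \<noteq> 0"
  shows "f \<in> scale_set l K \<longleftrightarrow> (\<lambda>x. f x / l) \<in> K"
proof
  assume "f \<in> scale_set l K"
  then obtain k where "k \<in> K" "f = (\<lambda>x. l * k x)" unfolding scale_set_def by blast
  then show "(\<lambda>x. f x / l) \<in> K" using assms by simp
next
  assume "(\<lambda>x. f x / l) \<in> K"
  moreover have "f = (\<lambda>x. l * (f x / l))" using assms by simp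
  ultimately show "f \<in> scale_set l K"
    unfolding scale_set_def mem_Collect_eq by (intro bexI[of _ "\<lambda>x. f x / l"])
qed

text \<open>The empty set is vacuously absolutely convex, so this degenerate case has to be covered:
  the empty sum still gives the functions that vanish almost everywhere.\<close>

lemma L0_span_empty_iff: "f \<in> L0_span M {} \<longleftrightarrow> f \<in> borel_measurable M \<and> (AE x in M. f x = 0)"
proof
  assume "f \<in> L0_span M {}"
  then obtain n :: nat and c k where "f \<in> borel_measurable M" "\<forall>i<n. k i \<in> {}"
    and eq: "AE x in M. f x = (\<Sum>i<n. c i * k i x)"
    unfolding L0_span_def ae_eq_def by blast
  moreover from this have "n = 0" by (metis empty_iff gr0I)
  ultimately show "f \<in> borel_measurable M \<and> (AE x in M. f x = 0)" by simp
next
  assume "f \<in> borel_measurable M \<and> (AE x in M. f x = 0)"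
  then show "f \<in> L0_span M {}"
    unfolding L0_span_def ae_eq_def by (intro CollectI conjI exI[of _ 0]) auto
qed

text \<open>By bilinearity it suffices to multiply generators, and a product of an element of
  \<open>K\<close> with one of its polar has \<open>L\<^sup>1\<close> norm at most 1.\<close>

lemma integrable_L0_span_polar:
  assumes f: "f \<in> L0_span M K" and g: "g \<in> L0_span M (polar M K)"
    and K: "K \<subseteq> borel_measurable M"
  shows "integrable M (\<lambda>x. f x * g x)"
proof -
  obtain n :: nat and a k where k: "\<And>i. i < n \<Longrightarrow> k i \<in> K"
    and f_eq: "AE x in M. f x = (\<Sum>i<n. a i * k i x)" and [measurable]: "f \<in> borel_measurable M"
    using f unfolding L0_span_def ae_eq_def by blast
  obtain m :: nat and b p where p: "\<And>j. j < m \<Longrightarrow> p j \<in> polar M K"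
    and g_eq: "AE x in M. g x = (\<Sum>j<m. b j * p j x)" and [measurable]: "g \<in> borel_measurable M"
    using g unfolding L0_span_def ae_eq_def by blast
  have kp: "integrable M (\<lambda>x. k i x * p j x)" if "i < n" "j < m" for i j
  proof (rule integrableI_bounded)
    have [measurable]: "k i \<in> borel_measurable M" "p j \<in> borel_measurable M"
      using k[OF that(1)] p[OF that(2)] K by (auto simp: polar_def)
    show "(\<lambda>x. k i x * p j x) \<in> borel_measurable M" by measurable
    have "(\<integral>\<^sup>+ x. ennreal \<bar>k i x * p j x\<bar> \<partial>M) \<le> 1"
      using p[OF that(2)] k[OF that(1)] by (simp add: polar_def SUP_le_iff)
    also have "(1 :: ennreal) < \<infinity>" by simp
    finally show "(\<integral>\<^sup>+ x. ennreal (norm (k i x * p j x)) \<partial>M) < \<infinity>" by simp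
  qed
  have int: "integrable M (\<lambda>x. \<Sum>i<n. \<Sum>j<m. (a i * b j) * (k i x * p j x))"
    by (intro Bochner_Integration.integrable_sum integrable_mult_right kp) auto
  have "AE x in M. (\<Sum>i<n. \<Sum>j<m. (a i * b j) * (k i x * p j x)) = f x * g x"
    using f_eq g_eq
  proof eventually_elim
    case (elim x)
    then show ?case by (simp add: sum_product mult_ac)
  qed
  moreover have "(\<lambda>x. f x * g x) \<in> borel_measurable M" by measurable
  ultimately show ?thesis
    using integrable_cong_AE_imp[OF int] by blast
qed

locale closed_absconvex = prob_space M for M :: "'a measure" +
  fixes K :: "('a \<Rightarrow> real) set"
  assumes K_meas: "K \<subseteq> borel_measurable M"
    and K_absconvex: "absolutely_convex K"
    and K_closed: "closed_in_prob M K"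
begin

abbreviation "E \<equiv> L0_span M K"

lemma scale_set_meas: "f \<in> scale_set l K \<Longrightarrow> f \<in> borel_measurable M"
  using K_meas unfolding scale_set_def by auto

lemma scale_set_subset_span: "scale_set l K \<subseteq> E"
proof
  fix f assume f: "f \<in> scale_set l K"
  then obtain k where "k \<in> K" "f = (\<lambda>x. l * k x)" unfolding scale_set_def by blast
  then show "f \<in> E"
    unfolding L0_span_def ae_eq_def using scale_set_meas[OF f]
    by (intro CollectI conjI exI[of _ "1::nat"] exI[of _ "\<lambda>_. l"] exI[of _ "\<lambda>_. k"]) auto
qed

text \<open>After division by \<open>l\<close>, the combination has coefficients
  \<open>a * r / l\<close> and \<open>b * s / l\<close> with respect to elements of
  \<open>K\<close>. Allowing slack in \<open>l\<close> also covers monotonicity in the scale and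
  membership of 0.\<close>

lemma scale_set_combination:
  assumes f: "f \<in> scale_set r K" and g: "g \<in> scale_set s K" and r: "r > 0" and s: "s > 0"
    and le: "\<bar>a\<bar> * r + \<bar>b\<bar> * s \<le> l" and l: "l > 0"
  shows "(\<lambda>x. a * f x + b * g x) \<in> scale_set l K"
proof -
  have K: "(\<lambda>x. f x / r) \<in> K" "(\<lambda>x. g x / s) \<in> K"
    using f g r s by (simp_all add: scale_set_iff)
  have "\<bar>a * r / l\<bar> + \<bar>b * s / l\<bar> \<le> 1"
    using le l r s by (simp add: abs_mult add_divide_distrib[symmetric])
  then have "(\<lambda>x. (a * r / l) * (f x / r) + (b * s / l) * (g x / s)) \<in> K"
    by (rule K_absconvex[unfolded absolutely_convex_def, rule_format, OF K])
  moreover have "(\<lambda>x. (a * r / l) * (f x / r) + (b * s / l) * (g x / s))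
      = (\<lambda>x. (a * f x + b * g x) / l)"
    using r s by (simp add: fun_eq_iff add_divide_distrib)
  ultimately show ?thesis using l by (simp add: scale_set_iff)
qed

lemma scale_set_mono:
  assumes "0 < l" "l \<le> l'"
  shows "scale_set l K \<subseteq> scale_set l' K"
proof
  fix f assume "f \<in> scale_set l K"
  then show "f \<in> scale_set l' K"
    using scale_set_combination[of f l f l 1 0 l'] assms by simp
qed

text \<open>Closedness of \<open>K\<close> in probability, rescaled. Applied to a constant sequence
  it also permits a change of representative.\<close>

lemma scale_set_AE_lim:
  assumes l: "l > 0" and fs: "\<And>n. fs n \<in> scale_set l K" and f [measurable]: "f \<in> borel_measurable M"
    and ae: "AE x in M. (\<lambda>n. fs n x) \<longlonglongrightarrow> f x"
  shows "f \<in> scale_set l K"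
proof -
  have K: "(\<lambda>x. fs n x / l) \<in> K" for n using fs[of n] l by (simp add: scale_set_iff)
  have [measurable]: "fs n \<in> borel_measurable M" for n using fs by (rule scale_set_meas)
  have "conv_in_prob M (\<lambda>n x. fs n x / l) (\<lambda>x. f x / l)"
  proof (rule conv_in_prob_if_AE)
    show "AE x in M. (\<lambda>n. fs n x / l) \<longlonglongrightarrow> f x / l"
      using ae by (rule eventually_mono) (use l in \<open>intro tendsto_divide tendsto_const, auto\<close>)
  qed measurable
  then have "(\<lambda>x. f x / l) \<in> K"
    by (rule K_closed[unfolded closed_in_prob_def, THEN conjunct2, rule_format, OF K, rotated])
      measurable
  then show ?thesis using l by (simp add: scale_set_iff)
qed

text \<open>Absolute convexity makes \<open>K\<close> absorbing in its span; closedness takes care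
  of the almost everywhere equality in the definition of the span.\<close>

lemma in_span_imp_in_scale_set:
  assumes f: "f \<in> E" and ne: "K \<noteq> {}"
  obtains l where "l > 0" "f \<in> scale_set l K"
proof -
  obtain n :: nat and a k where k: "\<And>i. i < n \<Longrightarrow> k i \<in> K"
    and f_eq: "AE x in M. f x = (\<Sum>i<n. a i * k i x)" and [measurable]: "f \<in> borel_measurable M"
    using f unfolding L0_span_def ae_eq_def by blast
  obtain k0 where k0: "k0 \<in> K" using ne by blast
  \<comment> \<open>The summand 1 keeps the scale positive even for an empty sum.\<close>
  define l where "l m = 1 + (\<Sum>i<m. \<bar>a i\<bar>)" for m
  have l: "l m > 0" for m unfolding l_def by (intro add_pos_nonneg sum_nonneg) auto
  have "(\<lambda>x. \<Sum>i<m. a i * k i x) \<in> scale_set (l m) K" if "m \<le> n" for m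
    using that
  proof (induction m)
    case 0
    have "k0 \<in> scale_set 1 K" using k0 by (simp add: scale_set_iff)
    then show ?case
      using scale_set_combination[of k0 1 k0 1 0 0 1] by (simp add: l_def)
  next
    case (Suc m)
    have "k m \<in> scale_set 1 K" using k Suc.prems by (simp add: scale_set_iff)
    with Suc have "(\<lambda>x. 1 * (\<Sum>i<m. a i * k i x) + a m * k m x) \<in> scale_set (l (Suc m)) K"
      by (intro scale_set_combination[of _ "l m" _ 1] l) (auto simp: l_def)
    then show ?case by simp
  qed
  then have sum: "(\<lambda>x. \<Sum>i<n. a i * k i x) \<in> scale_set (l n) K" by simp
  have "f \<in> scale_set (l n) K"
  proof (rule scale_set_AE_lim[OF l sum])
    show "AE x in M. (\<lambda>_. \<Sum>i<n. a i * k i x) \<longlonglongrightarrow> f x"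
      using f_eq by (rule eventually_mono) simp
  qed measurable
  with l show ?thesis by (rule that)
qed

lemma span_combination:
  assumes f: "f \<in> E" and g: "g \<in> E"
  shows "(\<lambda>x. a * f x + b * g x) \<in> E"
proof (cases "K = {}")
  case True
  have [measurable]: "f \<in> borel_measurable M" "g \<in> borel_measurable M"
    using f g unfolding L0_span_def by blast+
  have "AE x in M. f x = 0" "AE x in M. g x = 0"
    using f g unfolding True L0_span_empty_iff by blast+
  then have "AE x in M. a * f x + b * g x = 0" by eventually_elim simp
  moreover have "(\<lambda>x. a * f x + b * g x) \<in> borel_measurable M" by measurable
  ultimately show ?thesis unfolding True L0_span_empty_iff by blast
next
  case False
  obtain r s where r: "r > 0" "f \<in> scale_set r K" and s: "s > 0" "g \<in> scale_set s K"
    using in_span_imp_in_scale_set[OF f False] in_span_imp_in_scale_set[OF g False] by metis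
  have "(\<lambda>x. a * f x + b * g x) \<in> scale_set (\<bar>a\<bar> * r + \<bar>b\<bar> * s + 1) K"
    using r s by (intro scale_set_combination[of f r g s]) (auto intro!: add_nonneg_pos)
  then show ?thesis using scale_set_subset_span by blast
qed

text \<open>Scaling is continuous for the weak topology because each pairing is homogeneous. For
  \<open>\<tau>\<close> no compatibility with scaling is assumed, so compactness of the scaled
  copies is obtained on the weak side.\<close>

lemma compactin_weak_top_scale_set:
  assumes compact: "compactin (weak_top M E F) K"
  shows "compactin (weak_top M E F) (scale_set l K)"
proof -
  have "continuous_map (weak_top M E F) (weak_top M E F) (\<lambda>f x. l * f x)"
  proof (rule continuous_map_into_weak_top)
    show "(\<lambda>f x. l * f x) ` topspace (weak_top M E F) \<subseteq> E"
      using span_combination[where a = l and b = 0] by auto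
    fix g assume "g \<in> F"
    moreover have "pairing M (\<lambda>x. l * f x) g = l * pairing M f g" for f
      by (simp add: pairing_def mult.assoc)
    ultimately show "continuous_map (weak_top M E F) euclideanreal (\<lambda>f. pairing M (\<lambda>x. l * f x) g)"
      by (simp add: continuous_map_real_mult continuous_map_pairing)
  qed
  moreover have "scale_set l K = (\<lambda>f x. l * f x) ` K"
    unfolding scale_set_def by blast
  ultimately show ?thesis using image_compactin[OF compact] by simp
qed

section \<open>Comparison of the Koethe topology with the weak topology on bounded sets\<close>

context
  fixes \<tau> :: "('a \<Rightarrow> real) topology" and F :: "('a \<Rightarrow> real) set"
  assumes dual: "integrable_dual M E F"
    and top: "topspace \<tau> = E" and compact: "compactin \<tau> K"
    and bounded_top: "\<And>A. K_bounded K A \<Longrightarrow> subtopology \<tau> A = subtopology (weak_top M E F) A"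
begin

lemma bounded_top_scale:
  "l > 0 \<Longrightarrow> subtopology \<tau> (scale_set l K) = subtopology (weak_top M E F) (scale_set l K)"
  by (rule bounded_top) (auto simp: K_bounded_def)

lemma compactin_weak_top_K: "compactin (weak_top M E F) K"
proof -
  have "scale_set 1 K = K" by (simp add: scale_set_def)
  then have "subtopology \<tau> K = subtopology (weak_top M E F) K"
    using bounded_top_scale[of 1] by simp
  moreover have "compactin (subtopology \<tau> K) K"
    using compact by (simp add: compactin_subtopology)
  ultimately show ?thesis by (simp add: compactin_subtopology)
qed

text \<open>On the scaled copy containing \<open>C\<close> both topologies agree, and this copy is
  weakly compact, so its relatively closed subset \<open>C\<close> is weakly compact too.\<close>

lemma closedin_imp_weakly_compact:
  assumes C: "closedin \<tau> C" "C \<subseteq> scale_set l K" and l: "l > 0"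
  shows "compactin (weak_top M E F) C"
proof -
  let ?W = "subtopology (weak_top M E F) (scale_set l K)"
  have "closedin ?W C"
    using C bounded_top_scale[OF l] by (metis closedin_subset_topspace)
  moreover have "compact_space ?W"
    using compactin_weak_top_scale_set[OF compactin_weak_top_K] by (rule compact_space_subtopology)
  ultimately have "compactin ?W C" by (rule closedin_compact_space[rotated])
  then show ?thesis by (simp add: compactin_subtopology)
qed

text \<open>The topologies agree only on bounded sets, while a point of the
  \<open>\<tau>\<close>-closure could a priori be anywhere in \<open>E\<close>. Since
  \<open>K\<close> absorbs its span, that point and \<open>C\<close> fit into one larger scaled
  copy, where the closures can be compared.\<close>

lemma closedin_if_weakly_closed:
  assumes C: "closedin (weak_top M E F) C" "C \<subseteq> scale_set l K" and l: "l > 0"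
  shows "closedin \<tau> C"
proof -
  have CE: "C \<subseteq> E" using C(2) scale_set_subset_span by blast
  have "\<tau> closure_of C \<subseteq> C"
  proof
    fix f assume f: "f \<in> \<tau> closure_of C"
    then have "C \<noteq> {}" by auto
    then have ne: "K \<noteq> {}" using C(2) unfolding scale_set_def by blast
    have "f \<in> E" using f top closure_of_subset_topspace[of \<tau> C] by blast
    then obtain r where r: "r > 0" "f \<in> scale_set r K" using in_span_imp_in_scale_set ne by blast
    define s where "s = max l r"
    have s: "s > 0" "C \<subseteq> scale_set s K" "f \<in> scale_set s K"
      using l r C(2) scale_set_mono[of l s] scale_set_mono[of r s] by (auto simp: s_def)
    have "f \<in> subtopology \<tau> (scale_set s K) closure_of C"
      using f s by (simp add: closure_of_subtopology inf.absorb2)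
    also have "\<dots> = subtopology (weak_top M E F) (scale_set s K) closure_of C"
      using bounded_top_scale[OF s(1)] by simp
    also have "\<dots> \<subseteq> weak_top M E F closure_of C"
      by (rule closure_of_subtopology_subset)
    also have "\<dots> = C" using C(1) by (simp add: closure_of_closedin)
    finally show "f \<in> C" .
  qed
  then show ?thesis using CE top closure_of_subset_eq[of C \<tau>] by simp
qed

text \<open>If the inequality fails, a subsequence stays in a sublevel set that misses
  \<open>f\<close>. The bounded part of this set is weakly compact, so it contains a version of the
  almost sure limit \<open>f\<close>, and \<open>\<phi>\<close> does not depend on the
  version.\<close>

lemma closed_sublevel_imp_Fatou:
  assumes inv: "\<And>f g. f \<in> E \<Longrightarrow> g \<in> E \<Longrightarrow> ae_eq M f g \<Longrightarrow> \<phi> f = \<phi> g"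
    and closed: "\<And>c eps. eps > 0 \<Longrightarrow> closedin \<tau> ({f \<in> E. \<phi> f \<le> ereal c} \<inter> scale_set eps K)"
  shows "equicont_Fatou M K \<phi>"
  unfolding equicont_Fatou_def
proof (intro allI impI)
  fix fs f assume bdd: "K_bounded K (range fs)" and f: "f \<in> E" and conv: "conv_in_prob M fs f"
  obtain l where l: "l > 0" and fs: "\<And>n. fs n \<in> scale_set l K"
    using bdd unfolding K_bounded_def by blast
  have fs_meas: "fs n \<in> borel_measurable M" for n using fs by (rule scale_set_meas)
  have f_meas: "f \<in> borel_measurable M" using f by (simp add: L0_span_def)
  show "\<phi> f \<le> liminf (\<lambda>n. \<phi> (fs n))"
    unfolding le_Liminf_iff
  proof (intro allI impI, rule ccontr)
    fix y assume y: "y < \<phi> f" and "\<not> eventually (\<lambda>n. y < \<phi> (fs n)) sequentially"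
    then have inf: "infinite {n. \<phi> (fs n) \<le> y}"
      by (simp add: not_eventually not_less frequently_cofinite[symmetric] cofinite_eq_sequentially)
    \<comment> \<open>\<open>y\<close> is an extended real and may be infinite, whereas the closed
      sublevel sets have real levels.\<close>
    obtain c where c: "y < ereal c" "ereal c < \<phi> f" using y ereal_dense2 by blast
    obtain r :: "nat \<Rightarrow> nat" where r: "strict_mono r" "\<And>n. \<phi> (fs (r n)) \<le> y"
      using infinite_enumerate[OF inf] by auto
    have "conv_in_prob M (\<lambda>n. fs (r n)) f"
      using conv LIMSEQ_subseq_LIMSEQ[OF _ r(1)] unfolding conv_in_prob_def o_def by fast
    \<comment> \<open>\<open>r\<close> selects indices with low values of \<open>\<phi>\<close>;
      \<open>q\<close> refines them to almost sure convergence.\<close>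
    then obtain q where ae: "AE x in M. (\<lambda>n. fs (r (q n)) x) \<longlonglongrightarrow> f x"
      using conv_in_prob_AE_subseq[OF fs_meas f_meas] by blast
    define C where "C = {f \<in> E. \<phi> f \<le> ereal c} \<inter> scale_set l K"
    have "compactin (weak_top M E F) C"
      unfolding C_def by (rule closedin_imp_weakly_compact[OF closed[OF l] _ l]) auto
    moreover have "fs (r (q n)) \<in> C" for n
      using fs[of "r (q n)"] r(2)[of "q n"] c(1) scale_set_subset_span
      unfolding C_def by (auto intro: order_trans less_imp_le)
    ultimately obtain f' where f': "f' \<in> C" "AE x in M. f' x = f x"
      using AE_limit_in_weakly_compact[OF dual _ _ f ae] by blast
    then have "\<phi> f' = \<phi> f" using f by (intro inv) (auto simp: C_def ae_eq_def)
    moreover have "\<phi> f' \<le> ereal c" using f'(1) by (simp add: C_def)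
    ultimately show False using c(2) by (simp add: leD)
  qed
qed

text \<open>An almost surely convergent sequence in the bounded sublevel set is
  \<open>K\<close>-bounded and converges in probability, so the Fatou property returns its limit to
  the set. Convexity turns this into weak closedness by
  \<open>closedin_weak_top_convex\<close>.\<close>

lemma Fatou_imp_closed_sublevel:
  assumes convex: "convex_fset {f \<in> E. \<phi> f \<le> ereal c}"
    and Fatou: "equicont_Fatou M K \<phi>" and eps: "eps > 0"
  shows "closedin \<tau> ({f \<in> E. \<phi> f \<le> ereal c} \<inter> scale_set eps K)"
proof (rule closedin_if_weakly_closed[OF _ _ eps])
  let ?C = "{f \<in> E. \<phi> f \<le> ereal c} \<inter> scale_set eps K"
  show "closedin (weak_top M E F) ?C"
  proof (rule closedin_weak_top_convex[OF dual])
    show "convex_fset ?C"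
      unfolding convex_fset_def
    proof (intro ballI allI impI)
      fix f g and t :: real
      assume fg: "f \<in> ?C" "g \<in> ?C" and t: "0 \<le> t \<and> t \<le> 1"
      have "(\<lambda>x. t * f x + (1 - t) * g x) \<in> {f \<in> E. \<phi> f \<le> ereal c}"
        using convex fg t unfolding convex_fset_def by blast
      moreover have "(\<lambda>x. t * f x + (1 - t) * g x) \<in> scale_set eps K"
        using fg t eps
        by (intro scale_set_combination[of f eps g eps]) (auto simp: algebra_simps)
      ultimately show "(\<lambda>x. t * f x + (1 - t) * g x) \<in> ?C" by blast
    qed
    fix cs f
    assume cs: "\<And>n. cs n \<in> ?C" and f: "f \<in> borel_measurable M"
      and ae: "AE x in M. (\<lambda>n. cs n x) \<longlonglongrightarrow> f x"
    have f_scale: "f \<in> scale_set eps K"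
      using cs by (intro scale_set_AE_lim[OF eps _ f ae]) blast
    have "conv_in_prob M cs f"
      using cs scale_set_meas by (intro conv_in_prob_if_AE f ae) blast
    moreover have "K_bounded K (range cs)"
      using cs eps unfolding K_bounded_def by blast
    moreover have "f \<in> E" using f_scale scale_set_subset_span by blast
    ultimately have "\<phi> f \<le> liminf (\<lambda>n. \<phi> (cs n))"
      by (intro Fatou[unfolded equicont_Fatou_def, rule_format])
    also have "\<dots> \<le> liminf (\<lambda>n. ereal c)"
      using cs by (intro Liminf_mono always_eventually) blast
    also have "\<dots> = ereal c" by (simp add: Liminf_const)
    finally show "f \<in> ?C" using f_scale scale_set_subset_span by blast
  qed blast
qed blast

end

lemma convex_sublevel:
  assumes "convex_proper_on M E \<phi>"
  shows "convex_fset {f \<in> E. \<phi> f \<le> ereal c}"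
  unfolding convex_fset_def
proof (intro ballI allI impI)
  fix f g and t :: real
  assume f: "f \<in> {f \<in> E. \<phi> f \<le> ereal c}" and g: "g \<in> {f \<in> E. \<phi> f \<le> ereal c}"
    and t: "0 \<le> t \<and> t \<le> 1"
  have "\<phi> (\<lambda>x. t * f x + (1 - t) * g x) \<le> ereal t * \<phi> f + ereal (1 - t) * \<phi> g"
    using assms f g t unfolding convex_proper_on_def by blast
  also have "\<dots> \<le> ereal t * ereal c + ereal (1 - t) * ereal c"
    using f g t by (intro add_mono ereal_mult_left_mono) auto
  also have "\<dots> = ereal c" by (simp add: algebra_simps)
  finally show "(\<lambda>x. t * f x + (1 - t) * g x) \<in> {f \<in> E. \<phi> f \<le> ereal c}"
    using span_combination f g by blast
qed

end

text \<open>Closed real sublevel sets are the complements of the open strict superlevel sets. The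
  assumption on \<open>\<phi>\<close> deals with the level minus infinity, which no single real
  sublevel set describes.\<close>

lemma lsc_wrt_iff_closed_sublevel:
  assumes "\<And>x. x \<in> topspace \<tau> \<Longrightarrow> \<phi> x \<noteq> - \<infinity>"
  shows "lsc_wrt \<tau> \<phi> \<longleftrightarrow> (\<forall>c::real. closedin \<tau> {x \<in> topspace \<tau>. \<phi> x \<le> ereal c})"
proof
  assume lsc: "lsc_wrt \<tau> \<phi>"
  show "\<forall>c::real. closedin \<tau> {x \<in> topspace \<tau>. \<phi> x \<le> ereal c}"
  proof
    fix c :: real
    have "openin \<tau> {x \<in> topspace \<tau>. ereal c < \<phi> x}"
    proof (subst openin_subopen, intro ballI)
      fix x assume "x \<in> {x \<in> topspace \<tau>. ereal c < \<phi> x}"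
      then obtain U where "openin \<tau> U" "x \<in> U" "\<forall>y\<in>U. ereal c < \<phi> y"
        using lsc unfolding lsc_wrt_def by blast
      then show "\<exists>U. openin \<tau> U \<and> x \<in> U \<and> U \<subseteq> {x \<in> topspace \<tau>. ereal c < \<phi> x}"
        using openin_subset by blast
    qed
    moreover have "topspace \<tau> - {x \<in> topspace \<tau>. ereal c < \<phi> x} = {x \<in> topspace \<tau>. \<phi> x \<le> ereal c}"
      by auto
    ultimately show "closedin \<tau> {x \<in> topspace \<tau>. \<phi> x \<le> ereal c}"
      using openin_closedin_eq by metis
  qed
next
  assume closed: "\<forall>c::real. closedin \<tau> {x \<in> topspace \<tau>. \<phi> x \<le> ereal c}"
  show "lsc_wrt \<tau> \<phi>"
    unfolding lsc_wrt_def
  proof (intro ballI allI impI)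
    fix x c assume x: "x \<in> topspace \<tau>" and c: "c < \<phi> x"
    show "\<exists>U. openin \<tau> U \<and> x \<in> U \<and> (\<forall>y\<in>U. c < \<phi> y)"
    proof (cases c)
      case (real r)
      have "openin \<tau> (topspace \<tau> - {x \<in> topspace \<tau>. \<phi> x \<le> ereal r})"
        using closed by (intro openin_diff openin_topspace) blast
      then show ?thesis using x c real
        by (intro exI[of _ "topspace \<tau> - {x \<in> topspace \<tau>. \<phi> x \<le> ereal r}"]) auto
    next
      case PInf
      then show ?thesis using c by simp
    next
      case MInf
      \<comment> \<open>Every value exceeds minus infinity, so the whole space serves as
        neighbourhood.\<close>
      then show ?thesis using x assms by (intro exI[of _ "topspace \<tau>"]) auto
    qed
  qed
qed

theorem theorem4p7:
  fixes M :: "'a measure" and K :: "('a \<Rightarrow> real) set"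
    and \<phi> :: "('a \<Rightarrow> real) \<Rightarrow> ereal" and \<tau> :: "('a \<Rightarrow> real) topology"
  assumes "prob_space M" and "complete_measure M"
    and "K \<subseteq> borel_measurable M"
    and "absolutely_convex K" and "closed_in_prob M K" and "bounded_in_prob M K"
    and "convex_proper_on M (L0_span M K) \<phi>"
    and "equicont_Koethe_topology M K \<tau>"
  shows "((\<forall>c::real. \<forall>eps>0. closedin \<tau> ({f \<in> L0_span M K. \<phi> f \<le> ereal c} \<inter> scale_set eps K))
            \<longleftrightarrow> equicont_Fatou M K \<phi>)
       \<and> (Krein_Smulian K \<tau> \<longrightarrow>
            ((\<forall>c::real. \<forall>eps>0. closedin \<tau> ({f \<in> L0_span M K. \<phi> f \<le> ereal c} \<inter> scale_set eps K))
               \<longleftrightarrow> lsc_wrt \<tau> \<phi>)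
            \<and> (equicont_Fatou M K \<phi> \<longleftrightarrow> lsc_wrt \<tau> \<phi>))"
proof -
  interpret prob_space M by fact
  interpret closed_absconvex M K by unfold_locales fact+
  obtain F where top: "topspace \<tau> = E" and compact: "compactin \<tau> K"
    and F: "F \<subseteq> L0_span M (polar M K)" "solid M F" "\<exists>h\<in>F. AE x in M. 0 < h x"
    and bounded_top: "\<And>A. K_bounded K A \<Longrightarrow> subtopology \<tau> A = subtopology (weak_top M E F) A"
    using assms(8) unfolding equicont_Koethe_topology_def by blast
  have dual: "integrable_dual M E F"
    unfolding integrable_dual_def
  proof (intro conjI ballI)
    show "integrable M (\<lambda>x. f x * g x)" if "f \<in> E" "g \<in> F" for f g
      using integrable_L0_span_polar K_meas F(1) that by blast
  qed (use F in \<open>auto simp: L0_span_def\<close>)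
  have inv: "\<phi> f = \<phi> g" if "f \<in> E" "g \<in> E" "ae_eq M f g" for f g
    using assms(7) that unfolding convex_proper_on_def by blast
  note convex = convex_sublevel[OF assms(7)]
  have Fatou: "(\<forall>c::real. \<forall>eps>0. closedin \<tau> ({f \<in> E. \<phi> f \<le> ereal c} \<inter> scale_set eps K))
      \<longleftrightarrow> equicont_Fatou M K \<phi>"
  proof (intro iffI allI impI)
    assume closed: "\<forall>c::real. \<forall>eps>0. closedin \<tau> ({f \<in> E. \<phi> f \<le> ereal c} \<inter> scale_set eps K)"
    show "equicont_Fatou M K \<phi>"
    proof (rule closed_sublevel_imp_Fatou[OF dual top compact])
      show "closedin \<tau> ({f \<in> E. \<phi> f \<le> ereal c} \<inter> scale_set eps K)" if "eps > 0" for c eps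
        using closed that by blast
    qed (fact bounded_top inv)+
  next
    fix c eps :: real assume "equicont_Fatou M K \<phi>" "eps > 0"
    then show "closedin \<tau> ({f \<in> E. \<phi> f \<le> ereal c} \<inter> scale_set eps K)"
      by (intro Fatou_imp_closed_sublevel[OF dual top compact _ convex] bounded_top)
  qed
  have "lsc_wrt \<tau> \<phi> \<longleftrightarrow> (\<forall>c::real. closedin \<tau> {f \<in> E. \<phi> f \<le> ereal c})"
    using assms(7) unfolding top[symmetric] convex_proper_on_def
    by (intro lsc_wrt_iff_closed_sublevel) blast
  \<comment> \<open>The Krein-Smulian property, applied to the convex sublevel set at level
    \<open>c\<close>, trades its closedness for that of its intersections with all scaled copies of
    \<open>K\<close>.\<close>
  moreover have "closedin \<tau> {f \<in> E. \<phi> f \<le> ereal c} \<longleftrightarrow>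
      (\<forall>eps>0. closedin \<tau> ({f \<in> E. \<phi> f \<le> ereal c} \<inter> scale_set eps K))"
    if KS: "Krein_Smulian K \<tau>" for c
  proof -
    have "{f \<in> E. \<phi> f \<le> ereal c} \<subseteq> topspace \<tau>" unfolding top by blast
    then show ?thesis
      by (rule KS[unfolded Krein_Smulian_def, THEN spec, THEN mp, THEN mp, OF _ convex])
  qed
  ultimately have "Krein_Smulian K \<tau> \<Longrightarrow>
      (\<forall>c::real. \<forall>eps>0. closedin \<tau> ({f \<in> E. \<phi> f \<le> ereal c} \<inter> scale_set eps K)) \<longleftrightarrow> lsc_wrt \<tau> \<phi>"
    by (simp only:)
  with Fatou show ?thesis by (intro conjI impI) (simp_all only:)
qed

end
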